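(* Let $P,Q$ be two curves in $\mathbb{R}^d$ with $m_1$ and $m_2$ vertices, respectively, and let $M=\max\{m_1,m_2\}$. Let $K\ge 1$ be an integer, let $r>0$, and let $\delta=4dr\cdot\left\lceil\frac{M}{K}\right\rceil$ and $c=4d^{3/2}\cdot\left\lceil\frac{M}{K}\right\rceil$. Let $t=(t_1,\dots,t_K)$ have independent entries uniformly distributed in $[0,\delta)^d$, and, independently of $t$, let the partition $\Phi^s(P)$ be chosen uniformly at random among all partitions of $P$ given by nondecreasing sequences $s\in\{1,\dots,m_1\}^{K-1}$. Then: (i) if $d_F(P,Q)<r$, then $\Pr_{t,s}\left(g^{t,s}_{\delta,K}(P)=g^{t,*}_{\delta,K}(Q)\right)>\left(\frac14\right)^K\cdot\left(\frac1M\right)^{K-1}$; (ii) if $d_F(P,Q)>cr$, then $\Pr_{t,s}\left(g^{t,s}_{\delta,K}(P)=g^{t,*}_{\delta,K}(Q)\right)=0$.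
   Context: A curve in $\mathbb{R}^d$ is given by its finite sequence of vertices $P=p_1,\dots,p_m\in\mathbb{R}^d$, $m\geq 1$; two curves are equal if their vertex sequences are equal. Given curves $P=p_1,\dots,p_{m_1}$ and $Q=q_1,\dots,q_{m_2}$, a traversal is a sequence of index pairs $T=(i_1,j_1),\dots,(i_\ell,j_\ell)$ with $(i_1,j_1)=(1,1)$, $(i_\ell,j_\ell)=(m_1,m_2)$, and, for every $k<\ell$, $i_{k+1}-i_k\in\{0,1\}$, $j_{k+1}-j_k\in\{0,1\}$ and $(i_{k+1}-i_k)+(j_{k+1}-j_k)\ge 1$. The discrete Fréchet distance is $d_F(P,Q)=\min_{T}\max_{(i,j)\in T}\|p_i-q_j\|$, over all traversals $T$, with $\|\cdot\|$ the Euclidean norm. Basic hash function: for $\delta>0$ let $G_\delta=\{(x_1,\dots,x_d): x_i\in\delta\mathbb{Z}\ \forall i\}$ and, for $t\in[0,\delta)^d$, $\widehat G^t_\delta=\{p+t: p\in G_\delta\}$. For a curve $P=p_1,\dots,p_m$, the curve $h^t_\delta(P)$ is obtained by (1) replacing each vertex $p_i$ by its closest point $p_i'$ of $\widehat G^t_\delta$ (ties broken by a fixed rule, say the lexicographically smallest closest point), and (2) removing consecutive duplicates, i.e., removing $p_i'$ whenever it is identical to $p_{i-1}'$. Partition of the input curve: for $P=p_1,\dots,p_m$ and a nondecreasing sequence $s\in\{1,\dots,m\}^{K-1}$, $\Phi^s(P)=(\widehat P_1,\dots,\widehat P_K)$ where $\widehat P_i=p_{s_{i-1}},\dots,p_{s_i}$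 with the convention $s_0=1$, $s_K=m$ (consecutive subsequences share one vertex). The hash of the input curve is the concatenation of vertex sequences $g^{t,s}_{\delta,K}(P)=h^{t_1}_\delta(\widehat P_1)\oplus\dots\oplus h^{t_K}_\delta(\widehat P_K)$. Partition of the query curve: $Q=q_1,\dots,q_m$ is subdivided deterministically into $K$ equal-sized subsequences, where the last may be shorter and two consecutive subsequences overlap by one vertex: $\Phi^*(Q)=(\widehat Q_1,\dots,\widehat Q_K)$ with $\widehat Q_i=q_{\rho_{i-1}},\dots,q_{\rho_i}$, $\rho_i=\min\{1+i\lceil (m-1)/K\rceil,\,m\}$. Its hash is $g^{t,*}_{\delta,K}(Q)=h^{t_1}_\delta(\widehat Q_1)\oplus\dots\oplus h^{t_K}_\delta(\widehat Q_K)$, with the same $t$ as for $P$. *)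

theory Defs
  imports "HOL-Probability.Probability" "HOL-Library.Fun_Lexorder"
begin

text \<open>
  A curve is a nonempty list of points of \<open>real ^ 'n\<close>, where \<open>d = CARD('n)\<close>; the class
  \<open>linorder\<close> on the index type is needed only for the lexicographic tie-breaking rule in
  \<open>snap\<close>. Vertices are numbered from 1, so that \<open>p\<^sub>i\<close> is \<open>P ! (i - 1)\<close>.
\<close>

type_synonym 'n point = "(real, 'n) vec"
type_synonym 'n curve = "'n point list"

definition traversals :: "nat \<Rightarrow> nat \<Rightarrow> (nat \<times> nat) list set" where
  "traversals m1 m2 = {T. T \<noteq> [] \<and> hd T = (1, 1) \<and> last T = (m1, m2) \<and>
     successively (\<lambda>(i, j) (i', j').
       i' \<in> {i, i + 1} \<and> j' \<in> {j, j + 1} \<and> (i', j') \<noteq> (i, j)) T}"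

text \<open>For nonempty curves there is at least one traversal, and only finitely many.\<close>

definition frechet :: "('n::finite) curve \<Rightarrow> 'n curve \<Rightarrow> real" where
  "frechet P Q = (MIN T \<in> traversals (length P) (length Q).
     MAX (i, j) \<in> set T. norm (P ! (i - 1) - Q ! (j - 1)))"

definition grid :: "real \<Rightarrow> 'n::finite point \<Rightarrow> 'n point set" where
  "grid \<delta> t = {p + t | p. \<forall>i. \<exists>k::int. p $ i = \<delta> * of_int k}"

definition closest_points :: "'n::finite point set \<Rightarrow> 'n point \<Rightarrow> 'n point set" where
  "closest_points G x = {y \<in> G. \<forall>z \<in> G. dist x y \<le> dist x z}"

definition snap :: "real \<Rightarrow> 'n point \<Rightarrow> 'n point \<Rightarrow> 'n::{finite,linorder} point" where
  "snap \<delta> t x = (THE y. y \<in> closest_points (grid \<delta> t) x \<and>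
     (\<forall>z \<in> closest_points (grid \<delta> t) x. z \<noteq> y \<longrightarrow> less_fun (\<lambda>i. y $ i) (\<lambda>i. z $ i)))"

definition basic_hash :: "real \<Rightarrow> 'n point \<Rightarrow> 'n curve \<Rightarrow> 'n::{finite,linorder} curve" where
  "basic_hash \<delta> t P = remdups_adj (map (snap \<delta> t) P)"

text \<open>The subcurve \<open>p\<^sub>a, \<dots>, p\<^sub>b\<close>.\<close>

definition subcurve :: "'n curve \<Rightarrow> nat \<Rightarrow> nat \<Rightarrow> 'n curve" where
  "subcurve P a b = map (\<lambda>i. P ! (i - 1)) [a..<b + 1]"

text \<open>
  A sequence \<open>s\<^sub>1, \<dots>, s\<^bsub>K-1\<^esub>\<close> is a list of length \<open>K - 1\<close>; the list \<open>1 # s @ [m]\<close> adds the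
  conventional entries \<open>s\<^sub>0 = 1\<close> and \<open>s\<^sub>K = m\<close>, and has \<open>s\<^sub>i\<close> at position \<open>i\<close>. Different
  \<open>s\<close> give different partitions, because the pieces have different lengths. So a uniformly
  random partition is the same as a uniformly random sequence.
\<close>

definition split_seqs :: "nat \<Rightarrow> nat \<Rightarrow> nat list set" where
  "split_seqs K m = {s. length s = K - 1 \<and> set s \<subseteq> {1..m} \<and> sorted s}"

definition input_partition :: "nat \<Rightarrow> nat list \<Rightarrow> 'n curve \<Rightarrow> 'n curve list" where
  "input_partition K s P =
     map (\<lambda>i. subcurve P ((1 # s @ [length P]) ! (i - 1)) ((1 # s @ [length P]) ! i)) [1..<K + 1]"

definition query_split :: "nat \<Rightarrow> nat \<Rightarrow> nat \<Rightarrow> nat" where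
  "query_split K m i = min (1 + i * nat \<lceil>(real m - 1) / real K\<rceil>) m"

definition query_partition :: "nat \<Rightarrow> 'n curve \<Rightarrow> 'n curve list" where
  "query_partition K Q =
     map (\<lambda>i. subcurve Q (query_split K (length Q) (i - 1)) (query_split K (length Q) i)) [1..<K + 1]"

definition concat_hash :: "real \<Rightarrow> (nat \<Rightarrow> 'n point) \<Rightarrow> 'n curve list \<Rightarrow> 'n::{finite,linorder} curve"
  where "concat_hash \<delta> t Cs =
     concat (map (\<lambda>i. basic_hash \<delta> (t i) (Cs ! (i - 1))) [1..<length Cs + 1])"

definition hash_input ::
    "real \<Rightarrow> nat \<Rightarrow> (nat \<Rightarrow> 'n point) \<Rightarrow> nat list \<Rightarrow> 'n curve \<Rightarrow> 'n::{finite,linorder} curve" where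
  "hash_input \<delta> K t s P = concat_hash \<delta> t (input_partition K s P)"

definition hash_query ::
    "real \<Rightarrow> nat \<Rightarrow> (nat \<Rightarrow> 'n point) \<Rightarrow> 'n curve \<Rightarrow> 'n::{finite,linorder} curve" where
  "hash_query \<delta> K t Q = concat_hash \<delta> t (query_partition K Q)"

definition cube :: "real \<Rightarrow> 'n::finite point set" where
  "cube \<delta> = {x. \<forall>i. 0 \<le> x $ i \<and> x $ i < \<delta>}"

text \<open>
  The joint law of \<open>(t, s)\<close> for input curves with \<open>m\<close> vertices: \<open>t\<^sub>1, \<dots>, t\<^sub>K\<close> are independent
  and uniform on the cube, and \<open>s\<close> is uniform and independent of \<open>t\<close>.
\<close>

definition hash_law :: "real \<Rightarrow> nat \<Rightarrow> nat \<Rightarrow> ((nat \<Rightarrow> 'n::finite point) \<times> nat list) measure" where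
  "hash_law \<delta> K m =
     (\<Pi>\<^sub>M i\<in>{1..K}. uniform_measure lborel (cube \<delta>)) \<Otimes>\<^sub>M measure_pmf (pmf_of_set (split_seqs K m))"

end

theory Submission
  imports Defs
begin

text \<open>
  Snapping moves a vertex by at most \<open>sqrt d * \<delta> / 2\<close>, so each curve lies within that
  Frechet distance of its hash; if the hashes agree, the triangle inequality gives (ii), since
  \<open>c * r = sqrt d * \<delta>\<close>.

  For (i), take a traversal \<open>T\<close> with all distances below \<open>r\<close> and split \<open>P\<close> at the first
  vertices matched by \<open>T\<close> with the splitting vertices of \<open>Q\<close>. The hashes of two corresponding pieces
  agree unless, for some vertex of the piece of \<open>Q\<close> and some coordinate, a cell boundary separates
  it from a vertex of \<open>P\<close> matched with it. Each such event has probability at most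
  \<open>2 * r / \<delta>\<close>, and less than \<open>r / \<delta>\<close> if there is only one matched vertex. With
  \<open>L = \<lceil>M / K\<rceil>\<close>, a piece with \<open>n \<le> L + 1\<close> vertices thus fails with probability less than
  \<open>d * (2 * n - 1) * r / \<delta> \<le> 3 / 4\<close>. The last piece has to absorb all remaining vertices
  of \<open>P\<close>, but there \<open>n \<le> L\<close>. Finally there are at most \<open>M ^ (K - 1)\<close> sequences \<open>s\<close>.
\<close>

section \<open>Couplings and traversals\<close>

text \<open>Traversals in recursive form: the lists are consumed from the front, and
  \<open>left\<close>, \<open>right\<close>, \<open>both\<close> say which heads are dropped.
  Relating entries instead of positions turns transitivity, duplicate removal and concatenation into
  list inductions.\<close>

inductive coupled :: "('a \<Rightarrow> 'b \<Rightarrow> bool) \<Rightarrow> 'a list \<Rightarrow> 'b list \<Rightarrow> bool" for R where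
  single: "R x y \<Longrightarrow> coupled R [x] [y]"
| left: "coupled R xs (y # ys) \<Longrightarrow> R x y \<Longrightarrow> coupled R (x # xs) (y # ys)"
| right: "coupled R (x # xs) ys \<Longrightarrow> R x y \<Longrightarrow> coupled R (x # xs) (y # ys)"
| both: "coupled R xs ys \<Longrightarrow> R x y \<Longrightarrow> coupled R (x # xs) (y # ys)"

lemma coupled_nonempty: "coupled R xs ys \<Longrightarrow> xs \<noteq> [] \<and> ys \<noteq> []"
  by (induction rule: coupled.induct) auto

lemma coupled_Nil [simp]: "\<not> coupled R [] ys" "\<not> coupled R xs []"
  using coupled_nonempty by blast+

lemma coupled_mono:
  assumes "coupled R xs ys"
    and "\<And>x y. x \<in> set xs \<Longrightarrow> y \<in> set ys \<Longrightarrow> R x y \<Longrightarrow> S x y"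
  shows "coupled S xs ys"
  using assms by (induction rule: coupled.induct) (auto intro: coupled.intros)

lemma coupled_map:
  "coupled (\<lambda>x y. R (f x) (g y)) xs ys \<Longrightarrow> coupled R (map f xs) (map g ys)"
  by (induction rule: coupled.induct) (auto intro: coupled.intros)

lemma coupled_sym: "coupled R xs ys \<Longrightarrow> coupled (\<lambda>y x. R x y) ys xs"
  by (induction rule: coupled.induct) (auto intro: coupled.intros)

lemma coupled_hd: "coupled R xs ys \<Longrightarrow> R (hd xs) (hd ys)"
  by (induction rule: coupled.induct) auto

lemma coupled_right_covered: "coupled R xs ys \<Longrightarrow> y \<in> set ys \<Longrightarrow> \<exists>x\<in>set xs. R x y"
  by (induction rule: coupled.induct) auto

text \<open>By induction on the total length, looking at the first step of each coupling. A step
  that keeps the head of the middle list \<open>ys\<close> is made on its own side alone; otherwise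
  both couplings leave that head together. This carries the triangle inequality.\<close>

lemma coupled_trans:
  assumes "coupled R xs ys" and "coupled S ys zs"
  shows "coupled (R OO S) xs zs"
  using assms
proof (induction "length xs + length ys + length zs" arbitrary: xs ys zs rule: less_induct)
  case less
  have IH: "coupled (R OO S) xs' zs'"
    if "coupled R xs' ys'" "coupled S ys' zs'"
      "length xs' + length ys' + length zs' < length xs + length ys + length zs" for xs' ys' zs'
    using less.hyps that by blast
  obtain x xs' y ys' z zs' where l: "xs = x # xs'" "ys = y # ys'" "zs = z # zs'"
    using less.prems coupled_nonempty by (metis list.exhaust)
  have xy: "R x y" and yz: "S y z"
    using coupled_hd[OF less.prems(1)] coupled_hd[OF less.prems(2)] l by auto
  then have xz: "(R OO S) x z" by blast
  have c1: "xs' = [] \<and> ys' = [] \<or> coupled R xs' ys \<or> coupled R xs ys' \<or> coupled R xs' ys'"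
    using less.prems(1) l by (cases rule: coupled.cases) auto
  have c2: "ys' = [] \<and> zs' = [] \<or> coupled S ys' zs \<or> coupled S ys zs' \<or> coupled S ys' zs'"
    using less.prems(2) l by (cases rule: coupled.cases) auto
  consider "coupled R xs' ys" | "coupled S ys zs'"
    | "ys' = []" "xs' = []" "zs' = []"
    | "coupled R xs ys' \<or> coupled R xs' ys'" "coupled S ys' zs \<or> coupled S ys' zs'"
    using c1 c2 by fastforce
  then show ?case
  proof cases
    case 1
    then show ?thesis
      using IH[of xs' ys zs] less.prems(2) l xz by (auto intro: coupled.left)
  next
    case 2
    then show ?thesis
      using IH[of xs ys zs'] less.prems(1) l xz by (auto intro: coupled.right)
  next
    case 3
    then show ?thesis using l xz by (auto intro: coupled.single)
  next
    case 4
    \<comment> \<open>Both couplings drop \<open>y\<close>. If they drop nothing else, the induction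
      hypothesis for the shorter middle list is already the claim.\<close>
    then show ?thesis
      using IH[of xs ys' zs] IH[of xs' ys' zs] IH[of xs ys' zs'] IH[of xs' ys' zs'] l xz
      by (auto intro: coupled.intros)
  qed
qed

text \<open>A one-sided step keeps the opposite head, which equals both the dropped entry and its
  successor, so it drops a duplicate.\<close>

lemma coupled_eq_remdups_adj: "coupled (=) xs ys \<Longrightarrow> remdups_adj xs = remdups_adj ys"
proof (induction rule: coupled.induct)
  case (left xs y ys x)
  then show ?case using coupled_hd[OF left(1)] coupled_nonempty[OF left(1)] by (cases xs) auto
next
  case (right x xs ys y)
  then show ?case using coupled_hd[OF right(1)] coupled_nonempty[OF right(1)] by (cases ys) auto
qed (simp_all add: remdups_adj_Cons)

text \<open>A run of equal images is matched with its single survivor.\<close>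

lemma coupled_remdups_adj: "xs \<noteq> [] \<Longrightarrow> coupled (\<lambda>x y. y = f x) xs (remdups_adj (map f xs))"
proof (induction xs rule: induct_list012)
  case (3 x x' xs)
  then have IH: "coupled (\<lambda>x y. y = f x) (x' # xs) (remdups_adj (f x' # map f xs))" by simp
  obtain zs where zs: "remdups_adj (f x' # map f xs) = f x' # zs"
    by (metis remdups_adj_Cons_alt)
  show ?case
    using IH zs by (cases "f x = f x'") (auto intro: coupled.intros)
qed (auto intro: coupled.intros)

text \<open>The vertex \<open>v\<close> shared by two pieces occurs once in the glued list: it is
  matched with the end of \<open>zs\<close> and stays put while the other side moves on to the head
  of \<open>zs'\<close>.\<close>

lemma coupled_glue:
  assumes "coupled R (xs @ [v]) zs" and "coupled R (v # ys) zs'"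
  shows "coupled R (xs @ v # ys) (zs @ zs')"
  using assms
proof (induction "xs @ [v]" zs arbitrary: xs rule: coupled.induct)
  case (single x y)
  then show ?case by (auto intro: coupled.right)
next
  case (left us y ws x)
  then obtain xs' where "xs = x # xs'" "us = xs' @ [v]"
    using coupled_nonempty[OF left(1)] by (cases xs) auto
  then show ?case using left by (auto intro: coupled.left)
next
  case (right x us ws y)
  then show ?case by (cases xs) (auto intro: coupled.right)
next
  case (both us ws x y)
  then obtain xs' where "xs = x # xs'" "us = xs' @ [v]"
    using coupled_nonempty[OF both(1)] by (cases xs) auto
  then show ?case using both by (auto intro: coupled.both)
qed

section \<open>Traversals as chains of index pairs, and their translation into couplings and
  back\<close>

lemma traversals_Cons_shift:
  assumes T: "T \<in> traversals a b" and d: "d \<le> 1" "e \<le> 1" "d + e \<noteq> 0"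
  shows "(1, 1) # map (\<lambda>(i, j). (i + d, j + e)) T \<in> traversals (a + d) (b + e)"
proof -
  \<comment> \<open>The three nonzero choices are the coupling steps \<open>left\<close>,
    \<open>right\<close> and \<open>both\<close>.\<close>
  have "d = 0 \<or> d = 1" "e = 0 \<or> e = 1" using d by auto
  then show ?thesis
    using T d
    by (auto simp: traversals_def successively_Cons hd_map last_map successively_map
        elim!: successively_mono)
qed

text \<open>Neither index ever decreases, so the first and last pairs bound all others. Keeping
  \<open>x \<noteq> y\<close> makes the relation strict, which yields distinctness in
  \<open>finite_traversals\<close>.\<close>

lemma traversals_bounds:
  assumes "T \<in> traversals a b"
  shows "sorted_wrt (\<lambda>x y. fst x \<le> fst y \<and> snd x \<le> snd y \<and> x \<noteq> y) T"
    and "set T \<subseteq> {1..a} \<times> {1..b}"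
proof -
  have T: "T \<noteq> []" "hd T = (1, 1)" "last T = (a, b)" using assms by (auto simp: traversals_def)
  have "successively (\<lambda>x y. fst x \<le> fst y \<and> snd x \<le> snd y \<and> x \<noteq> y) T"
    using assms by (auto simp: traversals_def elim!: successively_mono)
  then show s: "sorted_wrt (\<lambda>x y. fst x \<le> fst y \<and> snd x \<le> snd y \<and> x \<noteq> y) T"
    by (subst (asm) successively_conv_sorted_wrt) (auto simp: transp_def prod_eq_iff)
  show "set T \<subseteq> {1..a} \<times> {1..b}"
  proof
    fix z assume z: "z \<in> set T"
    then obtain k where k: "k < length T" "z = T ! k" by (metis in_set_conv_nth)
    have le: "fst (T ! i) \<le> fst (T ! j) \<and> snd (T ! i) \<le> snd (T ! j)" if "i \<le> j" "j < length T" for i j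
      using that s by (cases "i = j") (auto simp: sorted_wrt_iff_nth_less)
    show "z \<in> {1..a} \<times> {1..b}"
      using le[of 0 k] le[of k "length T - 1"] k T
      by (auto simp: hd_conv_nth last_conv_nth prod_eq_iff mem_Times_iff)
  qed
qed

lemma finite_traversals: "finite (traversals a b)"
proof (rule finite_subset)
  show "traversals a b \<subseteq> {T. set T \<subseteq> {1..a} \<times> {1..b} \<and> distinct T}"
  proof
    fix T assume T: "T \<in> traversals a b"
    have "sorted_wrt (\<noteq>) T"
      using traversals_bounds(1)[OF T] by (rule sorted_wrt_mono_rel[rotated]) auto
    then show "T \<in> {T. set T \<subseteq> {1..a} \<times> {1..b} \<and> distinct T}"
      using traversals_bounds(2)[OF T] by (simp add: distinct_conv_nth sorted_wrt_iff_nth_less) (metis linorder_neqE_nat)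
  qed
  show "finite {T. set T \<subseteq> {1..a} \<times> {1..b} \<and> distinct T}"
    by (rule finite_subset_distinct) auto
qed

lemma traversal_of_coupled:
  assumes "coupled R xs ys"
  shows "\<exists>T \<in> traversals (length xs) (length ys). \<forall>(i, j) \<in> set T. R (xs ! (i - 1)) (ys ! (j - 1))"
  using assms
proof (induction rule: coupled.induct)
  case (single x y)
  show ?case by (rule bexI[of _ "[(1, 1)]"]) (auto simp: traversals_def single)
next
  case (left xs y ys x)
  then obtain T where T: "T \<in> traversals (length xs) (length (y # ys))"
    "\<forall>(i, j) \<in> set T. R (xs ! (i - 1)) ((y # ys) ! (j - 1))" by blast
  have "(1, 1) # map (\<lambda>(i, j). (i + 1, j + 0)) T \<in> traversals (length xs + 1) (length (y # ys) + 0)"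
    by (rule traversals_Cons_shift[OF T(1)]) auto
  moreover have "R ((x # xs) ! i) ((y # ys) ! (j - 1))" if "(i, j) \<in> set T" for i j
  proof -
    \<comment> \<open>\<open>i - 1\<close> is truncated subtraction: only for \<open>0 < i\<close>
      is entry \<open>i\<close> of \<open>x # xs\<close> the old entry \<open>i - 1\<close>.\<close>
    have "0 < i" using that traversals_bounds(2)[OF T(1)] by auto
    then show ?thesis using that T(2) by (auto simp: nth_Cons')
  qed
  ultimately show ?case
    using left(2) by (intro bexI) auto
next
  case (right x xs ys y)
  then obtain T where T: "T \<in> traversals (length (x # xs)) (length ys)"
    "\<forall>(i, j) \<in> set T. R ((x # xs) ! (i - 1)) (ys ! (j - 1))" by blast
  have "(1, 1) # map (\<lambda>(i, j). (i + 0, j + 1)) T \<in> traversals (length (x # xs) + 0) (length ys + 1)"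
    by (rule traversals_Cons_shift[OF T(1)]) auto
  moreover have "R ((x # xs) ! (i - 1)) ((y # ys) ! j)" if "(i, j) \<in> set T" for i j
  proof -
    have "0 < j" using that traversals_bounds(2)[OF T(1)] by auto
    then show ?thesis using that T(2) by (auto simp: nth_Cons')
  qed
  ultimately show ?case
    using right(2) by (intro bexI) auto
next
  case (both xs ys x y)
  then obtain T where T: "T \<in> traversals (length xs) (length ys)"
    "\<forall>(i, j) \<in> set T. R (xs ! (i - 1)) (ys ! (j - 1))" by blast
  have "(1, 1) # map (\<lambda>(i, j). (i + 1, j + 1)) T \<in> traversals (length xs + 1) (length ys + 1)"
    by (rule traversals_Cons_shift[OF T(1)]) auto
  moreover have "R ((x # xs) ! i) ((y # ys) ! j)" if "(i, j) \<in> set T" for i j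
  proof -
    have "0 < i" "0 < j" using that traversals_bounds(2)[OF T(1)] by auto
    then show ?thesis using that T(2) by (auto simp: nth_Cons')
  qed
  ultimately show ?case
    using both(2) by (intro bexI) auto
qed

text \<open>Only the lengths matter, so lists of units are coupled under the always true relation
  and the coupling is converted.\<close>

lemma traversals_nonempty:
  assumes "0 < a" and "0 < b"
  shows "traversals a b \<noteq> {}"
proof -
  have 1: "coupled (\<lambda>_ _. True) [()] (replicate (Suc n) ())" for n
    by (induction n) (auto intro: coupled.intros)
  have "coupled (\<lambda>_ _. True) (replicate (Suc n) ()) (replicate (Suc k) ())" for n k
  proof (induction n)
    case (Suc n)
    then show ?case by (simp add: coupled.left)
  qed (use 1 in simp)
  from traversal_of_coupled[OF this[of "a - 1" "b - 1"]] show ?thesis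
    using assms by auto
qed

lemma frechet_le:
  assumes "coupled (\<lambda>x y. norm (x - y) \<le> e) P Q"
  shows "frechet P Q \<le> e"
proof -
  obtain T where T: "T \<in> traversals (length P) (length Q)"
    "\<forall>(i, j) \<in> set T. norm (P ! (i - 1) - Q ! (j - 1)) \<le> e"
    using traversal_of_coupled[OF assms] by blast
  then have "set T \<noteq> {}" by (auto simp: traversals_def)
  then have "(MAX (i, j) \<in> set T. norm (P ! (i - 1) - Q ! (j - 1))) \<le> e"
    using T(2) by (subst Max_le_iff) auto
  then show ?thesis
    unfolding frechet_def using T(1) finite_traversals
    by (meson Min_le finite_imageI image_eqI order_trans)
qed

text \<open>Yields the traversal itself, since part (i) must read off which vertices of
  \<open>P\<close> are matched with a given vertex of \<open>Q\<close>.\<close>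

lemma frechet_less:
  assumes "frechet P Q < e" and "P \<noteq> []" and "Q \<noteq> []"
  shows "\<exists>T \<in> traversals (length P) (length Q). \<forall>(i, j) \<in> set T. norm (P ! (i - 1) - Q ! (j - 1)) < e"
proof -
  have "\<exists>T \<in> traversals (length P) (length Q). (MAX (i, j) \<in> set T. norm (P ! (i - 1) - Q ! (j - 1))) < e"
    using assms traversals_nonempty[of "length P" "length Q"] finite_traversals
    unfolding frechet_def by (subst (asm) Min_less_iff) auto
  then obtain T where T: "T \<in> traversals (length P) (length Q)"
    "(MAX (i, j) \<in> set T. norm (P ! (i - 1) - Q ! (j - 1))) < e" by blast
  then have "set T \<noteq> {}" by (auto simp: traversals_def)
  then have "\<forall>z \<in> set T. (case z of (i, j) \<Rightarrow> norm (P ! (i - 1) - Q ! (j - 1))) < e"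
    using T(2) by (subst (asm) Max_less_iff) auto
  then show ?thesis using T(1) by auto
qed

text \<open>The coupled lists are index intervals, with membership in \<open>T\<close> as the
  relation. The chain may start at any pair, so the result applies to a stretch of a
  traversal.\<close>

lemma coupled_of_chain:
  assumes "T \<noteq> []"
    and "successively (\<lambda>(i, j) (i', j').
       i' \<in> {i, i + 1} \<and> j' \<in> {j, j + 1} \<and> (i', j') \<noteq> (i, j)) T"
  shows "coupled (\<lambda>i j. (i, j) \<in> set T)
    [fst (hd T)..<Suc (fst (last T))] [snd (hd T)..<Suc (snd (last T))]"
  using assms
proof (induction T rule: induct_list012)
  case (3 x y T)
  let ?a = "fst (last (y # T))" and ?b = "snd (last (y # T))"
  have IH: "coupled (\<lambda>i j. (i, j) \<in> set (x # y # T)) [fst y..<Suc ?a] [snd y..<Suc ?b]"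
  proof (rule coupled_mono)
    show "coupled (\<lambda>i j. (i, j) \<in> set (y # T)) [fst y..<Suc ?a] [snd y..<Suc ?b]"
      using 3(2,4) by (simp del: upt_Suc last.simps)
  qed auto
  have ne: "fst y \<le> ?a" "snd y \<le> ?b"
    using coupled_nonempty[OF IH] by (simp_all del: last.simps upt_Suc)
  have cons: "[k..<Suc n] = k # [Suc k..<Suc n]" if "k \<le> n" for k n :: nat
    using that by (simp add: upt_conv_Cons del: upt_Suc)
  have x: "(fst x, snd x) \<in> set (x # y # T)" by simp
  have step: "fst y \<in> {fst x, Suc (fst x)}" "snd y \<in> {snd x, Suc (snd x)}" "y \<noteq> x"
    using 3(4) by auto
  have "coupled (\<lambda>i j. (i, j) \<in> set (x # y # T)) [fst x..<Suc ?a] [snd x..<Suc ?b]"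
  proof (cases "fst y = fst x")
    case True
    then have "snd y = Suc (snd x)" using step by (auto simp: prod_eq_iff)
    then show ?thesis
      using IH ne x cons[of "fst x" ?a] cons[of "snd x" ?b] True by (metis Suc_leD coupled.right)
  next
    case False
    then have y1: "fst y = Suc (fst x)" using step by auto
    show ?thesis
    proof (cases "snd y = snd x")
      case True
      then show ?thesis
        using IH ne x cons[of "fst x" ?a] cons[of "snd x" ?b] y1 by (metis Suc_leD coupled.left)
    next
      case False
      then have "snd y = Suc (snd x)" using step by auto
      then show ?thesis
        using IH ne x cons[of "fst x" ?a] cons[of "snd x" ?b] y1 by (metis Suc_leD coupled.both)
    qed
  qed
  then show ?case by (simp del: upt_Suc)
qed (auto intro: coupled.intros)

lemma traversals_nth_mono:
  assumes "T \<in> traversals m n" and "k \<le> l" and "l < length T"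
  shows "fst (T ! k) \<le> fst (T ! l) \<and> snd (T ! k) \<le> snd (T ! l)"
  using traversals_bounds(1)[OF assms(1)] assms(2,3)
  by (cases "k = l") (auto simp: sorted_wrt_iff_nth_less)

lemma traversal_comparable:
  assumes "T \<in> traversals m n" and "(a, c) \<in> set T" and "(b, e) \<in> set T"
  shows "a \<le> b \<and> c \<le> e \<or> b \<le> a \<and> e \<le> c"
proof -
  obtain k l where kl: "k < length T" "T ! k = (a, c)" "l < length T" "T ! l = (b, e)"
    using assms(2,3) by (metis in_set_conv_nth)
  then show ?thesis
    using traversals_nth_mono[OF assms(1), of k l] traversals_nth_mono[OF assms(1), of l k]
    by (cases "k \<le> l") simp_all
qed

lemma coupled_of_traversal:
  assumes T: "T \<in> traversals m n" and ac: "(a, c) \<in> set T" and be: "(b, e) \<in> set T"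
    and le: "a \<le> b" "c \<le> e"
  shows "coupled (\<lambda>i j. (i, j) \<in> set T) [a..<Suc b] [c..<Suc e]"
proof -
  let ?S = "\<lambda>(i, j) (i', j'). i' \<in> {i, i + 1} \<and> j' \<in> {j, j + 1} \<and> (i', j') \<noteq> (i, j)"
  obtain k l where kl: "k < length T" "T ! k = (a, c)" "l < length T" "T ! l = (b, e)"
    using ac be by (metis in_set_conv_nth)
  have "\<exists>l. k \<le> l \<and> l < length T \<and> T ! l = (b, e)"
  proof (cases "k \<le> l")
    case False
    \<comment> \<open>If \<open>(b, e)\<close> was found before position \<open>k\<close>,
      monotonicity and \<open>le\<close> make the two pairs equal, and \<open>k\<close> itself
      serves.\<close>
    then have "b \<le> a" "e \<le> c"
      using traversals_nth_mono[OF T, of l k] kl by simp_all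
    then show ?thesis using kl le by auto
  qed (use kl in auto)
  then obtain l where l: "k \<le> l" "l < length T" "T ! l = (b, e)" by blast
  define U where "U = drop k (take (Suc l) T)"
  have "take k T @ U = take (Suc l) T"
    using append_take_drop_id[of k "take (Suc l) T"] l unfolding U_def by (simp add: min_absorb1)
  then have "T = take k T @ U @ drop (Suc l) T"
    by (metis append.assoc append_take_drop_id)
  then have "successively ?S (take k T @ U @ drop (Suc l) T)"
    using T by (simp add: traversals_def)
  then have s: "successively ?S U" by (simp add: successively_append_iff)
  have U: "U \<noteq> []" "hd U = (a, c)" "last U = (b, e)" "set U \<subseteq> set T"
    using l kl unfolding U_def
    by (auto simp: hd_drop_conv_nth last_conv_nth min_absorb2 dest!: in_set_dropD in_set_takeD)
  show ?thesis
    using coupled_mono[OF coupled_of_chain[OF U(1) s]] U by (simp add: subset_iff del: upt_Suc)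
qed

text \<open>No step skips an index. This makes the first matched vertex of \<open>P\<close> well
  defined for every vertex of \<open>Q\<close>.\<close>

lemma traversal_covers:
  assumes T: "T \<in> traversals m n" and j: "j \<in> {1..n}"
  shows "\<exists>i. (i, j) \<in> set T"
proof -
  have e: "(1, 1) \<in> set T" "(m, n) \<in> set T"
    using T unfolding traversals_def by (auto dest: hd_in_set last_in_set)
  have "1 \<le> m" "1 \<le> n" using traversals_bounds(2)[OF T] e by auto
  then have "coupled (\<lambda>i j. (i, j) \<in> set T) [1..<Suc m] [1..<Suc n]"
    using coupled_of_traversal[OF T e] by simp
  from coupled_right_covered[OF this, of j] show ?thesis
    using j by (auto simp: less_Suc_eq_le simp del: upt_Suc)
qed

section \<open>Snapping to the grid\<close>

text \<open>Rounding half down makes ties go to the smaller coordinate, as the rule in \<open>snap\<close> demands.\<close>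

definition cell :: "real \<Rightarrow> real \<Rightarrow> real \<Rightarrow> int" where
  "cell \<delta> \<tau> x = \<lceil>(x - \<tau>) / \<delta> - 1 / 2\<rceil>"

lemma cell_mono:
  assumes "0 < \<delta>" and "x \<le> y"
  shows "cell \<delta> \<tau> x \<le> cell \<delta> \<tau> y"
  unfolding cell_def using assms by (intro ceiling_mono diff_right_mono divide_right_mono) auto

text \<open>By monotonicity, one test at the ends of an interval decides for all points inside. The
  union bound thus needs one event per interval, not one per matched pair.\<close>

lemma cell_between:
  assumes "0 < \<delta>" and "cell \<delta> \<tau> a = cell \<delta> \<tau> b"
    and "a \<le> x" and "x \<le> b" and "a \<le> y" and "y \<le> b"
  shows "cell \<delta> \<tau> x = cell \<delta> \<tau> y"
  using assms cell_mono[of \<delta> a x \<tau>] cell_mono[of \<delta> x b \<tau>]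
    cell_mono[of \<delta> a y \<tau>] cell_mono[of \<delta> y b \<tau>] by linarith

text \<open>The ceiling makes the range half-open: a coordinate may move down by exactly
  \<open>\<delta> / 2\<close>, but never up by that much.\<close>

lemma cell_bounds:
  assumes "0 < \<delta>"
  shows "- \<delta> / 2 \<le> \<tau> + \<delta> * of_int (cell \<delta> \<tau> x) - x" and "\<tau> + \<delta> * of_int (cell \<delta> \<tau> x) - x < \<delta> / 2"
proof -
  have "(x - \<tau>) / \<delta> - 1 / 2 \<le> of_int (cell \<delta> \<tau> x)" "of_int (cell \<delta> \<tau> x) < (x - \<tau>) / \<delta> - 1 / 2 + 1"
    unfolding cell_def by linarith+
  then have "\<delta> * ((x - \<tau>) / \<delta> - 1 / 2) \<le> \<delta> * of_int (cell \<delta> \<tau> x)"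
    "\<delta> * of_int (cell \<delta> \<tau> x) < \<delta> * ((x - \<tau>) / \<delta> - 1 / 2 + 1)"
    using assms by simp_all
  moreover have scale: "\<delta> * ((x - \<tau>) / \<delta> - 1 / 2) = x - \<tau> - \<delta> / 2"
    using assms by (simp add: field_simps)
  ultimately show "- \<delta> / 2 \<le> \<tau> + \<delta> * of_int (cell \<delta> \<tau> x) - x" "\<tau> + \<delta> * of_int (cell \<delta> \<tau> x) - x < \<delta> / 2"
    using scale by (simp_all add: algebra_simps)
qed

lemma cell_nearest:
  fixes x \<tau> :: real and k :: int
  assumes "0 < \<delta>"
  defines "y \<equiv> \<tau> + \<delta> * of_int (cell \<delta> \<tau> x)" and "z \<equiv> \<tau> + \<delta> * of_int k"
  shows "\<bar>x - y\<bar> \<le> \<bar>x - z\<bar>" and "\<bar>x - z\<bar> = \<bar>x - y\<bar> \<Longrightarrow> y \<le> z"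
proof -
  have b: "- \<delta> / 2 \<le> y - x" "y - x < \<delta> / 2"
    using cell_bounds[OF assms(1)] unfolding y_def by auto
  \<comment> \<open>Any other grid coordinate differs from \<open>y\<close> by at least a full
    \<open>\<delta>\<close>.\<close>
  consider "k = cell \<delta> \<tau> x" | "z \<le> y - \<delta>" | "y + \<delta> \<le> z"
  proof -
    have "z \<le> y - \<delta>" if "k < cell \<delta> \<tau> x"
    proof -
      have "real_of_int k \<le> of_int (cell \<delta> \<tau> x) - 1" using that by linarith
      then have "\<delta> * of_int k \<le> \<delta> * (of_int (cell \<delta> \<tau> x) - 1)" using assms(1) by simp
      then show ?thesis unfolding y_def z_def by (simp add: algebra_simps)
    qed
    moreover have "y + \<delta> \<le> z" if "cell \<delta> \<tau> x < k"
    proof -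
      have "of_int (cell \<delta> \<tau> x) + 1 \<le> real_of_int k" using that by linarith
      then have "\<delta> * (of_int (cell \<delta> \<tau> x) + 1) \<le> \<delta> * of_int k" using assms(1) by simp
      then show ?thesis unfolding y_def z_def by (simp add: algebra_simps)
    qed
    ultimately show ?thesis using that by (meson linorder_cases)
  qed
  then have "\<bar>x - y\<bar> \<le> \<bar>x - z\<bar> \<and> (\<bar>x - z\<bar> = \<bar>x - y\<bar> \<longrightarrow> y \<le> z)"
  proof cases
    case 1
    then show ?thesis by (simp add: y_def z_def)
  next
    case 2
    then show ?thesis using b by linarith
  next
    case 3
    then show ?thesis using b by linarith
  qed
  then show "\<bar>x - y\<bar> \<le> \<bar>x - z\<bar>" and "\<bar>x - z\<bar> = \<bar>x - y\<bar> \<Longrightarrow> y \<le> z"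
    by blast+
qed

text \<open>Squared distance is a sum over coordinates, so coordinatewise rounding minimizes it. Any
  other closest point has the same distance in every coordinate, hence by the one-dimensional tie
  rule no smaller coordinate, and is lexicographically larger.\<close>

lemma snap_eq:
  fixes t x :: "'n::{finite,linorder} point"
  assumes "0 < \<delta>"
  shows "snap \<delta> t x = (\<chi> i. t $ i + \<delta> * of_int (cell \<delta> (t $ i) (x $ i)))"
proof -
  define y where "y = (\<chi> i. t $ i + \<delta> * of_int (cell \<delta> (t $ i) (x $ i)))"
  have grid: "z \<in> grid \<delta> t \<longleftrightarrow> (\<forall>i. \<exists>k::int. z $ i = t $ i + \<delta> * of_int k)" for z
  proof
    assume "z \<in> grid \<delta> t"
    then show "\<forall>i. \<exists>k::int. z $ i = t $ i + \<delta> * of_int k"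
      unfolding grid_def by (auto simp: add.commute)
  next
    assume z: "\<forall>i. \<exists>k::int. z $ i = t $ i + \<delta> * of_int k"
    have "\<forall>i. \<exists>k::int. (z - t) $ i = \<delta> * of_int k"
      using z by (auto simp: algebra_simps)
    moreover have "z = (z - t) + t" by simp
    ultimately show "z \<in> grid \<delta> t" unfolding grid_def by blast
  qed
  have near: "\<bar>(x - y) $ i\<bar> \<le> \<bar>(x - z) $ i\<bar>" "\<bar>(x - z) $ i\<bar> = \<bar>(x - y) $ i\<bar> \<Longrightarrow> y $ i \<le> z $ i"
    if z: "z \<in> grid \<delta> t" for z i
  proof -
    obtain k :: int where "z $ i = t $ i + \<delta> * of_int k" using z grid by blast
    then show "\<bar>(x - y) $ i\<bar> \<le> \<bar>(x - z) $ i\<bar>" "\<bar>(x - z) $ i\<bar> = \<bar>(x - y) $ i\<bar> \<Longrightarrow> y $ i \<le> z $ i"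
      using cell_nearest[OF assms, of "x $ i" "t $ i" k] by (auto simp: y_def)
  qed
  have y: "y \<in> closest_points (grid \<delta> t) x"
    unfolding closest_points_def
  proof (intro CollectI conjI ballI)
    show "y \<in> grid \<delta> t" unfolding grid y_def by auto
    show "dist x y \<le> dist x z" if "z \<in> grid \<delta> t" for z
      unfolding dist_norm using near(1)[OF that] by (intro norm_le_componentwise_cart) auto
  qed
  have least: "less_fun (\<lambda>i. y $ i) (\<lambda>i. z $ i)"
    if z: "z \<in> closest_points (grid \<delta> t) x" "z \<noteq> y" for z
  proof -
    have zg: "z \<in> grid \<delta> t" and "dist x z \<le> dist x y"
      using z y unfolding closest_points_def by auto
    then have "(norm (x - z))\<^sup>2 \<le> (norm (x - y))\<^sup>2" by (simp add: dist_norm)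
    then have le: "(\<Sum>i\<in>UNIV. ((x - z) $ i)\<^sup>2) \<le> (\<Sum>i\<in>UNIV. ((x - y) $ i)\<^sup>2)"
      by (simp add: norm_vec_def L2_set_def sum_nonneg)
    have sq: "((x - y) $ i)\<^sup>2 \<le> ((x - z) $ i)\<^sup>2" for i
      using near(1)[OF zg] abs_le_square_iff by blast
    have "\<bar>(x - z) $ i\<bar> = \<bar>(x - y) $ i\<bar>" for i
    proof (rule ccontr)
      assume "\<bar>(x - z) $ i\<bar> \<noteq> \<bar>(x - y) $ i\<bar>"
      then have "((x - z) $ i)\<^sup>2 \<noteq> ((x - y) $ i)\<^sup>2" by (metis real_sqrt_abs)
      then have "((x - y) $ i)\<^sup>2 < ((x - z) $ i)\<^sup>2" using sq[of i] by linarith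
      then have "(\<Sum>i\<in>UNIV. ((x - y) $ i)\<^sup>2) < (\<Sum>i\<in>UNIV. ((x - z) $ i)\<^sup>2)"
        using sq by (intro sum_strict_mono_ex1) auto
      then show False using le by simp
    qed
    then have le: "y $ i \<le> z $ i" for i using near(2)[OF zg] by blast
    \<comment> \<open>The first differing coordinate decides the lexicographic order.\<close>
    define k where "k = Min {i. y $ i \<noteq> z $ i}"
    have ne: "{i. y $ i \<noteq> z $ i} \<noteq> {}" using z(2) by (metis (mono_tags, lifting) empty_iff mem_Collect_eq vec_eq_iff)
    have "k \<in> {i. y $ i \<noteq> z $ i}" unfolding k_def by (rule Min_in) (use ne in auto)
    moreover have "y $ j = z $ j" if "j < k" for j
    proof (rule ccontr)
      assume "y $ j \<noteq> z $ j"
      then have "k \<le> j" unfolding k_def by (intro Min_le) auto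
      then show False using that by simp
    qed
    ultimately show ?thesis
      unfolding less_fun_def using le[of k] by (intro exI[of _ k]) auto
  qed
  show ?thesis
    unfolding snap_def y_def[symmetric]
  proof (rule the_equality, intro conjI ballI impI)
    fix z assume z: "z \<in> closest_points (grid \<delta> t) x \<and>
      (\<forall>w\<in>closest_points (grid \<delta> t) x. w \<noteq> z \<longrightarrow> less_fun (\<lambda>i. z $ i) (\<lambda>i. w $ i))"
    show "z = y"
    proof (rule ccontr)
      assume "z \<noteq> y"
      then have "less_fun (\<lambda>i. z $ i) (\<lambda>i. y $ i)" "less_fun (\<lambda>i. y $ i) (\<lambda>i. z $ i)"
        using z y least[of z] by auto
      then show False by (rule less_fun_asym[THEN notE])
    qed
  qed (use y least in auto)
qed

lemma norm_snap_le:
  fixes t x :: "'n::{finite,linorder} point"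
  assumes "0 < \<delta>"
  shows "norm (x - snap \<delta> t x) \<le> sqrt (real CARD('n)) * (\<delta> / 2)"
proof -
  have "\<bar>(x - snap \<delta> t x) $ i\<bar> \<le> \<bar>(\<chi> i. \<delta> / 2) $ i\<bar>" for i
  proof -
    have "\<bar>x $ i - (t $ i + \<delta> * of_int (cell \<delta> (t $ i) (x $ i)))\<bar> \<le> \<delta> / 2"
      using cell_bounds[OF assms, of "t $ i" "x $ i"] by linarith
    then show ?thesis using assms by (simp add: snap_eq)
  qed
  then have "norm (x - snap \<delta> t x) \<le> norm ((\<chi> i. \<delta> / 2) :: 'n point)"
    by (intro norm_le_componentwise_cart) auto
  also have "\<dots> = sqrt (real CARD('n)) * (\<delta> / 2)"
    using assms by (simp add: norm_vec_def L2_set_def real_sqrt_mult real_sqrt_divide)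
  finally show ?thesis .
qed

lemma borel_measurable_snap [measurable]:
  fixes f :: "'w \<Rightarrow> 'n::{finite,linorder} point"
  assumes "0 < \<delta>" and f: "f \<in> borel_measurable M"
  shows "(\<lambda>w. snap \<delta> (f w) x) \<in> borel_measurable M"
proof -
  have [measurable]: "(\<lambda>w. f w $ i) \<in> borel_measurable M" for i
    using f by (rule measurable_compose) simp
  have "(\<lambda>w. \<chi> i. f w $ i + \<delta> * of_int \<lceil>(x $ i - f w $ i) / \<delta> - 1 / 2\<rceil>) \<in> borel_measurable M"
    by (subst borel_measurable_euclidean_space) (auto simp: Basis_vec_def inner_axis)
  then show ?thesis by (simp add: snap_eq[OF assms(1)] cell_def)
qed

section \<open>Measurability of the collision event\<close>

text \<open>
  A class of random curves that contains the hashes, and in which equality of two members is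
  an event.
\<close>

inductive random_curve :: "'w measure \<Rightarrow> ('w \<Rightarrow> ('n::finite) curve) \<Rightarrow> bool" for M where
  Nil: "random_curve M (\<lambda>w. [])"
| Cons: "f \<in> borel_measurable M \<Longrightarrow> random_curve M F \<Longrightarrow> random_curve M (\<lambda>w. f w # F w)"
| If: "Measurable.pred M c \<Longrightarrow> random_curve M F \<Longrightarrow> random_curve M G \<Longrightarrow>
    random_curve M (\<lambda>w. if c w then F w else G w)"

lemma random_curve_append:
  assumes "random_curve M F" and "random_curve M G"
  shows "random_curve M (\<lambda>w. F w @ G w)"
  using assms
proof (induction rule: random_curve.induct)
  case (If c F F')
  have "(\<lambda>w. (if c w then F w else F' w) @ G w) = (\<lambda>w. if c w then F w @ G w else F' w @ G w)"
    by auto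
  then show ?case using If by (simp add: random_curve.If)
qed (auto intro: random_curve.Cons)

lemma random_curve_concat:
  "(\<And>i. i \<in> set I \<Longrightarrow> random_curve M (F i)) \<Longrightarrow> random_curve M (\<lambda>w. concat (map (\<lambda>i. F i w) I))"
  by (induction I) (auto intro: random_curve.Nil random_curve_append)

text \<open>Induction on both derivations compares the curves entry by entry and turns each
  conditional into a case split between events.\<close>

lemma pred_random_curve_eq:
  assumes "random_curve M F" and "random_curve M G"
  shows "Measurable.pred M (\<lambda>w. F w = G w)"
  using assms
proof (induction arbitrary: G rule: random_curve.induct)
  case Nil
  then show ?case
  proof (induction rule: random_curve.induct)
    case (If c F G)
    have "(\<lambda>w. [] = (if c w then F w else G w)) = (\<lambda>w. if c w then [] = F w else [] = G w)" by auto
    then show ?case using If by simp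
  qed auto
next
  case (Cons f F)
  show ?case
    using Cons(4)
  proof (induction rule: random_curve.induct)
    case (Cons g G)
    then show ?case
      using \<open>f \<in> borel_measurable M\<close> \<open>\<And>G. random_curve M G \<Longrightarrow> Measurable.pred M (\<lambda>w. F w = G w)\<close>
      by simp
  next
    case (If c G G')
    have "(\<lambda>w. f w # F w = (if c w then G w else G' w)) =
        (\<lambda>w. if c w then f w # F w = G w else f w # F w = G' w)" by auto
    then show ?case using If by simp
  qed auto
next
  case (If c F F')
  have "(\<lambda>w. (if c w then F w else F' w) = G w) = (\<lambda>w. if c w then F w = G w else F' w = G w)"
    by auto
  then show ?case using If by simp
qed

text \<open>Removing consecutive duplicates branches only on whether two neighbouring snapped
  vertices agree, which is an event.\<close>

lemma random_curve_basic_hash: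
  fixes f :: "'w \<Rightarrow> 'n::{finite,linorder} point"
  assumes "0 < \<delta>" and [measurable]: "f \<in> borel_measurable M"
  shows "random_curve M (\<lambda>w. basic_hash \<delta> (f w) P)"
  unfolding basic_hash_def
proof (induction P rule: induct_list012)
  case (3 x y P)
  note [measurable] = borel_measurable_snap[OF assms]
  have "(\<lambda>w. remdups_adj (map (snap \<delta> (f w)) (x # y # P))) =
      (\<lambda>w. if snap \<delta> (f w) x = snap \<delta> (f w) y then remdups_adj (map (snap \<delta> (f w)) (y # P))
        else snap \<delta> (f w) x # remdups_adj (map (snap \<delta> (f w)) (y # P)))"
    by auto
  then show ?case
    using 3 by (simp add: random_curve.If random_curve.Cons)
qed (simp_all add: random_curve.Nil random_curve.Cons borel_measurable_snap assms)

section \<open>Collision of a single piece\<close>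

text \<open>The half-open cube lies between the open and the closed box, which have equal
  volume.\<close>

lemma cube_measure:
  assumes "0 < \<delta>"
  shows "cube \<delta> \<in> sets (lborel :: 'n::finite point measure)"
    and "emeasure lborel (cube \<delta> :: 'n point set) = ennreal (\<delta> ^ CARD('n))"
proof -
  let ?u = "(\<chi> i. \<delta>) :: 'n point"
  have "cube \<delta> = (\<Inter>i. {x :: 'n point. 0 \<le> x $ i} \<inter> {x. x $ i < \<delta>})"
    by (auto simp: cube_def)
  also have "\<dots> \<in> sets lborel"
    by (intro sets.countable_INT'' sets.Int borel_closed borel_open)
      (auto intro!: closed_Collect_le open_Collect_less continuous_intros)
  finally show meas: "cube \<delta> \<in> sets (lborel :: 'n point measure)" .
  have "measure lborel (cbox 0 ?u) = \<delta> ^ CARD('n)"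
    using assms by (subst content_cbox_cart) (auto simp: interval_ne_empty_cart)
  moreover have "emeasure lborel (cbox 0 ?u) = ennreal (measure lborel (cbox 0 ?u))"
    by (rule emeasure_eq_ennreal_measure) (use emeasure_lborel_cbox_finite[of 0 ?u] in auto)
  moreover have "emeasure lborel (box 0 ?u) = emeasure lborel (cbox 0 ?u)"
    by (simp add: emeasure_lborel_box_eq emeasure_lborel_cbox_eq)
  moreover have "emeasure lborel (box 0 ?u) \<le> emeasure lborel (cube \<delta> :: 'n point set)"
    using meas by (intro emeasure_mono) (auto simp: cube_def mem_box_cart intro: less_imp_le)
  moreover have "emeasure lborel (cube \<delta> :: 'n point set) \<le> emeasure lborel (cbox 0 ?u)"
    by (intro emeasure_mono) (auto simp: cube_def mem_box_cart less_eq_real_def)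
  ultimately show "emeasure lborel (cube \<delta> :: 'n point set) = ennreal (\<delta> ^ CARD('n))"
    by simp
qed

lemma prob_space_uniform_cube:
  assumes "0 < \<delta>"
  shows "prob_space (uniform_measure lborel (cube \<delta> :: 'n::finite point set))"
  using assms by (intro prob_space_uniform_measure) (auto simp: cube_measure)

lemma borel_measurable_cell [measurable]:
  "f \<in> borel_measurable M \<Longrightarrow> (\<lambda>w. cell \<delta> (f w) x) \<in> measurable M (count_space UNIV)"
  unfolding cell_def
  by (intro measurable_compose[OF _ measurable_real_ceiling] borel_measurable_diff borel_measurable_divide
      borel_measurable_const)

lemma sets_cell_ne:
  "{t :: 'n::finite point. cell \<delta> (t $ j) a \<noteq> cell \<delta> (t $ j) b} \<in> sets borel"
proof -
  have [measurable]: "(\<lambda>t :: 'n point. t $ j) \<in> borel_measurable borel" by simp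
  show ?thesis by measurable
qed

lemma measure_slab:
  fixes j :: "'n::finite" and l u \<delta> :: real
  assumes "l \<le> u" and "0 \<le> \<delta>"
  shows "measure lborel (cbox (\<chi> i. if i = j then l else 0) (\<chi> i. if i = j then u else \<delta>) :: 'n point set)
    = (u - l) * \<delta> ^ (CARD('n) - 1)"
proof -
  have "(\<Prod>i\<in>UNIV. (if i = j then u else \<delta>) - (if i = j then l else 0)) =
      (\<Prod>i\<in>UNIV. if i = j then u - l else \<delta>)"
    by (intro prod.cong) auto
  also have "\<dots> = (u - l) * (\<Prod>i\<in>UNIV - {j}. if i = j then u - l else \<delta>)"
    by (subst prod.remove[of _ j]) auto
  also have "(\<Prod>i\<in>UNIV - {j}. if i = j then u - l else \<delta>) = (\<Prod>i\<in>UNIV - {j}. \<delta>)"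
    by (intro prod.cong) auto
  finally show ?thesis
    using assms by (subst content_cbox_cart) (auto simp: interval_ne_empty_cart card_Diff_singleton)
qed

text \<open>A boundary separates \<open>a\<close> from \<open>b\<close> exactly when
  \<open>t $ j\<close> lies, modulo \<open>\<delta>\<close>, in an interval of length
  \<open>b - a\<close>. For \<open>b - a \<le> \<delta>\<close> this interval wraps around at most
  once; otherwise the bound exceeds 1.\<close>

lemma prob_cell_ne:
  fixes j :: "'n::finite"
  assumes \<delta>: "0 < \<delta>" and ab: "a \<le> b"
  shows "measure (uniform_measure lborel (cube \<delta>))
    {t :: 'n point. cell \<delta> (t $ j) a \<noteq> cell \<delta> (t $ j) b} \<le> (b - a) / \<delta>"
    (is "measure ?N ?B \<le> _")
proof (cases "b - a \<le> \<delta>")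
  case False
  interpret prob_space ?N by (rule prob_space_uniform_cube[OF \<delta>])
  have "measure ?N ?B \<le> 1" by (rule prob_le_1)
  also have "1 \<le> (b - a) / \<delta>" using False \<delta> by simp
  finally show ?thesis .
next
  case True
  \<comment> \<open>Boundaries lie at \<open>t $ j + \<delta> / 2 + n * \<delta>\<close>.
    Subtracting \<open>\<delta> / 2 + of_int k * \<delta>\<close> moves \<open>a\<close> to
    \<open>u\<close> in \<open>[0, \<delta>)\<close> and \<open>b\<close> to \<open>v\<close>, so
    the question is whether some \<open>t $ j + n * \<delta>\<close> lies in
    \<open>[u, v)\<close>.\<close>
  define k where "k = \<lfloor>(a - \<delta> / 2) / \<delta>\<rfloor>"
  define u where "u = a - \<delta> / 2 - of_int k * \<delta>"
  define v where "v = u + (b - a)"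
  \<comment> \<open>\<open>?X\<close> covers the shifts with \<open>n = 0\<close>, and
    \<open>?Y\<close> those with \<open>n = 1\<close>, where the interval wraps past
    \<open>\<delta>\<close>. The trivial \<open>if\<close> in \<open>?Y\<close> keeps the shape of
    \<open>measure_slab\<close>.\<close>
  let ?X = "cbox (\<chi> i. if i = j then u else 0) (\<chi> i. if i = j then min v \<delta> else \<delta>) :: 'n point set"
  let ?Y = "cbox (\<chi> i. if i = j then 0 else 0) (\<chi> i. if i = j then max 0 (v - \<delta>) else \<delta>) :: 'n point set"
  have "of_int k \<le> (a - \<delta> / 2) / \<delta>" "(a - \<delta> / 2) / \<delta> < of_int k + 1"
    unfolding k_def by linarith+
  then have u: "0 \<le> u" "u < \<delta>" using \<delta> by (simp_all add: u_def field_simps)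
  then have v: "u \<le> v" "v \<le> 2 * \<delta>" using True ab by (simp_all add: v_def)
  have sub: "cube \<delta> \<inter> ?B \<subseteq> ?X \<union> ?Y"
  proof
    fix t assume t: "t \<in> cube \<delta> \<inter> ?B"
    define n where "n = cell \<delta> (t $ j) a - k"
    have cube: "0 \<le> t $ i" "t $ i < \<delta>" for i using t by (auto simp: cube_def)
    have "cell \<delta> (t $ j) a < cell \<delta> (t $ j) b" using t cell_mono[OF \<delta> ab, of "t $ j"] by auto
    \<comment> \<open>The boundary indexed by the cell of \<open>a\<close> lies between
      \<open>a\<close> and \<open>b\<close>.\<close>
    then have "(a - t $ j) / \<delta> - 1 / 2 \<le> of_int (cell \<delta> (t $ j) a)"
      "of_int (cell \<delta> (t $ j) a) < (b - t $ j) / \<delta> - 1 / 2"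
      unfolding cell_def by linarith+
    then have "a - t $ j - \<delta> / 2 \<le> of_int (cell \<delta> (t $ j) a) * \<delta>"
      "of_int (cell \<delta> (t $ j) a) * \<delta> < b - t $ j - \<delta> / 2"
      using \<delta> by (simp_all add: field_simps)
    then have n: "u \<le> t $ j + of_int n * \<delta>" "t $ j + of_int n * \<delta> < v"
      by (simp_all add: u_def v_def n_def algebra_simps)
    have "\<not> n \<le> - 1"
    proof
      assume "n \<le> - 1"
      then have "of_int n * \<delta> \<le> - 1 * \<delta>" using \<delta> by (intro mult_right_mono) auto
      then show False using n u cube[of j] by linarith
    qed
    moreover have "\<not> n \<ge> 2"
    proof
      assume "n \<ge> 2"
      then have "of_int n * \<delta> \<ge> 2 * \<delta>" using \<delta> by (intro mult_right_mono) auto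
      then show False using n v cube[of j] by linarith
    qed
    ultimately consider "n = 0" | "n = 1" by linarith
    then show "t \<in> ?X \<union> ?Y"
    proof cases
      case 1
      then have "t \<in> ?X" using n cube by (auto simp: mem_box_cart intro: less_imp_le)
      then show ?thesis by blast
    next
      case 2
      then have "t \<in> ?Y" using n cube by (auto simp: mem_box_cart intro: less_imp_le)
      then show ?thesis by blast
    qed
  qed
  have "measure lborel (cube \<delta> \<inter> ?B) \<le> measure lborel (?X \<union> ?Y)"
    using sub sets_cell_ne cube_measure(1)[OF \<delta>]
    by (intro measure_mono_fmeasurable fmeasurable.Un) auto
  also have "\<dots> \<le> measure lborel ?X + measure lborel ?Y"
    by (intro measure_Un_le) auto
  also have "\<dots> = (min v \<delta> - u) * \<delta> ^ (CARD('n) - 1) + (max 0 (v - \<delta>) - 0) * \<delta> ^ (CARD('n) - 1)"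
    using u v \<delta> by (subst (1 2) measure_slab) auto
  also have "\<dots> = (b - a) * \<delta> ^ (CARD('n) - 1)"
  proof -
    have "min v \<delta> - u + (max 0 (v - \<delta>) - 0) = b - a" by (simp add: v_def min_def max_def)
    then show ?thesis unfolding distrib_right[symmetric] by simp
  qed
  finally have le: "measure lborel (cube \<delta> \<inter> ?B) \<le> (b - a) * \<delta> ^ (CARD('n) - 1)" .
  have "measure ?N ?B = measure lborel (cube \<delta> \<inter> ?B) / \<delta> ^ CARD('n)"
    using \<delta> sets_cell_ne cube_measure[OF \<delta>, where 'n = 'n]
    by (subst measure_uniform_measure) (auto simp: measure_def)
  also have "\<dots> \<le> (b - a) * \<delta> ^ (CARD('n) - 1) / \<delta> ^ CARD('n)"
    using le \<delta> by (intro divide_right_mono) auto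
  also have "\<dots> = (b - a) / \<delta>"
    using \<delta> by (simp add: power_eq_if[of \<delta> "CARD('n)"])
  finally show ?thesis .
qed

text \<open>A union bound over the entries \<open>y\<close> of \<open>ys\<close> and the
  coordinates. The interval depends on \<open>y\<close> alone and holds all points matched with
  \<open>y\<close>, so the number of these points does not enter the bound.\<close>

lemma coupled_collision:
  fixes p :: "'a \<Rightarrow> 'n::{finite,linorder} point" and q lo hi :: "'b \<Rightarrow> 'n point"
  assumes \<delta>: "0 < \<delta>"
    and coupled: "coupled (\<lambda>x y. \<forall>j. p x $ j \<in> {lo y $ j..hi y $ j} \<and> q y $ j \<in> {lo y $ j..hi y $ j}) xs ys"
  shows "measure (uniform_measure lborel (cube \<delta>))
      {t. basic_hash \<delta> t (map p xs) = basic_hash \<delta> t (map q ys)}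
    \<ge> 1 - (\<Sum>y\<in>set ys. \<Sum>j\<in>UNIV. hi y $ j - lo y $ j) / \<delta>"
    (is "measure ?N ?E \<ge> _")
proof -
  interpret prob_space ?N by (rule prob_space_uniform_cube[OF \<delta>])
  let ?B = "\<lambda>y j. {t :: 'n point. cell \<delta> (t $ j) (lo y $ j) \<noteq> cell \<delta> (t $ j) (hi y $ j)}"
  define B where "B = (\<Union>z\<in>set ys \<times> UNIV. ?B (fst z) (snd z))"
  have B: "B \<in> sets ?N" unfolding B_def using sets_cell_ne by auto
  \<comment> \<open>Some \<open>x\<close> is matched with \<open>y\<close>, so the interval is
    nonempty.\<close>
  have le: "lo y $ j \<le> hi y $ j" if "y \<in> set ys" for y j
    using coupled_right_covered[OF coupled that] by (meson atLeastAtMost_iff order_trans)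
  have "measure ?N B \<le> (\<Sum>z\<in>set ys \<times> UNIV. measure ?N (?B (fst z) (snd z)))"
    unfolding B_def using sets_cell_ne by (intro finite_measure_subadditive_finite) auto
  also have "\<dots> \<le> (\<Sum>z\<in>set ys \<times> UNIV. (hi (fst z) $ snd z - lo (fst z) $ snd z) / \<delta>)"
    using le by (intro sum_mono prob_cell_ne[OF \<delta>]) auto
  also have "\<dots> = (\<Sum>y\<in>set ys. \<Sum>j\<in>UNIV. hi y $ j - lo y $ j) / \<delta>"
    by (simp add: sum.cartesian_product sum_divide_distrib case_prod_unfold)
  finally have "1 - (\<Sum>y\<in>set ys. \<Sum>j\<in>UNIV. hi y $ j - lo y $ j) / \<delta> \<le> 1 - measure ?N B" by simp
  also have "\<dots> = measure ?N (space ?N - B)" using B by (rule prob_compl[symmetric])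
  also have "\<dots> \<le> measure ?N ?E"
  proof (rule finite_measure_mono)
    have "random_curve ?N (\<lambda>t. basic_hash \<delta> t R)" for R :: "'n curve"
      by (rule random_curve_basic_hash[OF \<delta>]) simp
    from pred_random_curve_eq[OF this this]
    show "?E \<in> sets ?N" by (simp add: pred_def)
    show "space ?N - B \<subseteq> ?E"
    proof
      fix t assume "t \<in> space ?N - B"
      then have t: "cell \<delta> (t $ j) (lo y $ j) = cell \<delta> (t $ j) (hi y $ j)" if "y \<in> set ys" for y j
        using that by (auto simp: B_def)
      have "coupled (\<lambda>x y. snap \<delta> t (p x) = snap \<delta> t (q y)) xs ys"
      proof (rule coupled_mono[OF coupled])
        fix x y
        assume y: "y \<in> set ys"
          and xy: "\<forall>j. p x $ j \<in> {lo y $ j..hi y $ j} \<and> q y $ j \<in> {lo y $ j..hi y $ j}"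
        have "cell \<delta> (t $ j) (p x $ j) = cell \<delta> (t $ j) (q y $ j)" for j
          using xy by (intro cell_between[OF \<delta> t[OF y]]) auto
        then show "snap \<delta> t (p x) = snap \<delta> t (q y)" by (simp add: snap_eq[OF \<delta>])
      qed
      then have "coupled (=) (map (\<lambda>x. snap \<delta> t (p x)) xs) (map (\<lambda>y. snap \<delta> t (q y)) ys)"
        by (rule coupled_map)
      from coupled_eq_remdups_adj[OF this] show "t \<in> ?E"
        by (simp add: basic_hash_def comp_def)
    qed
  qed
  finally show ?thesis .
qed

lemma coord_bounds:
  fixes x y :: "'n::finite point"
  assumes "norm (x - y) < r"
  shows "y $ j - r \<le> x $ j" and "x $ j \<le> y $ j + r" and "\<bar>x $ j - y $ j\<bar> < r"
  using component_le_norm_cart[of "x - y" j] assms unfolding vector_minus_component by linarith+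

text \<open>Each of the \<open>e - c + 1\<close> vertices of the piece of \<open>Q\<close> gets an
  interval of width \<open>2 * r\<close> per coordinate. This serves the last piece, which cannot
  stop at a first match.\<close>

lemma collision_full:
  fixes P Q :: "'n::{finite,linorder} curve" and r \<delta> :: real
  assumes \<delta>: "0 < \<delta>" and r: "0 < r" and T: "T \<in> traversals m n"
    and near: "\<forall>(i, j) \<in> set T. norm (P ! (i - 1) - Q ! (j - 1)) < r"
    and ac: "(a, c) \<in> set T" and be: "(b, e) \<in> set T" and le: "a \<le> b" "c \<le> e"
  shows "measure (uniform_measure lborel (cube \<delta>))
      {t. basic_hash \<delta> t (subcurve P a b) = basic_hash \<delta> t (subcurve Q c e)}
    \<ge> 1 - CARD('n) * r * (2 * real (e - c) + 2) / \<delta>"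
proof -
  let ?p = "\<lambda>i. P ! (i - 1)" and ?q = "\<lambda>i. Q ! (i - 1)"
  let ?lo = "\<lambda>y. (\<chi> j. ?q y $ j - r) :: 'n point" and ?hi = "\<lambda>y. (\<chi> j. ?q y $ j + r) :: 'n point"
  have "coupled (\<lambda>x y. \<forall>j. ?p x $ j \<in> {?lo y $ j..?hi y $ j} \<and> ?q y $ j \<in> {?lo y $ j..?hi y $ j})
      [a..<b + 1] [c..<e + 1]"
    unfolding Suc_eq_plus1[symmetric]
  proof (rule coupled_mono[OF coupled_of_traversal[OF T ac be le]], intro allI)
    fix i y j assume "(i, y) \<in> set T"
    then have "norm (?p i - ?q y) < r" using near by blast
    from coord_bounds[OF this, of j] r
    show "?p i $ j \<in> {?lo y $ j..?hi y $ j} \<and> ?q y $ j \<in> {?lo y $ j..?hi y $ j}" by simp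
  qed
  note collision = coupled_collision[OF \<delta> this]
  have set: "set [c..<e + 1] = {c..e}" by auto
  have sum: "(\<Sum>y\<in>{c..e}. \<Sum>j\<in>UNIV. ?hi y $ j - ?lo y $ j) = CARD('n) * r * (2 * real (e - c) + 2)"
    using le by (simp add: algebra_simps of_nat_diff)
  show ?thesis using collision unfolding subcurve_def set sum .
qed

text \<open>
  When the piece of \<open>P\<close> stops at its first vertex matched with the last vertex of the piece of
  \<open>Q\<close>, that last vertex only has to share its cell with a single vertex of \<open>P\<close>. This saves
  \<open>r\<close> per coordinate, without which the bound is void for \<open>\<lceil>M / K\<rceil> = 1\<close>.
\<close>

lemma collision_first_match:
  fixes P Q :: "'n::{finite,linorder} curve" and r \<delta> :: real
  assumes \<delta>: "0 < \<delta>" and r: "0 < r" and T: "T \<in> traversals m n"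
    and near: "\<forall>(i, j) \<in> set T. norm (P ! (i - 1) - Q ! (j - 1)) < r"
    and ac: "(a, c) \<in> set T" and be: "(b, e) \<in> set T" and le: "a \<le> b" "c \<le> e"
    and first: "\<And>i. (i, e) \<in> set T \<Longrightarrow> b \<le> i"
  shows "measure (uniform_measure lborel (cube \<delta>))
      {t. basic_hash \<delta> t (subcurve P a b) = basic_hash \<delta> t (subcurve Q c e)}
    > 1 - CARD('n) * r * (2 * real (e - c) + 1) / \<delta>"
proof -
  let ?p = "\<lambda>i. P ! (i - 1)" and ?q = "\<lambda>i. Q ! (i - 1)"
  \<comment> \<open>At \<open>e\<close> the interval is spanned by the two points alone, so its
    width is less than \<open>r\<close> instead of \<open>2 * r\<close>.\<close>
  define lo where "lo y = (\<chi> j. if y = e then min (?p b $ j) (?q e $ j) else ?q y $ j - r)" for y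
  define hi where "hi y = (\<chi> j. if y = e then max (?p b $ j) (?q e $ j) else ?q y $ j + r)" for y
  have be': "norm (?p b - ?q e) < r" using near be by blast
  have "coupled (\<lambda>x y. \<forall>j. ?p x $ j \<in> {lo y $ j..hi y $ j} \<and> ?q y $ j \<in> {lo y $ j..hi y $ j})
      [a..<b + 1] [c..<e + 1]"
    unfolding Suc_eq_plus1[symmetric]
  proof (rule coupled_mono[OF coupled_of_traversal[OF T ac be le]], intro allI)
    fix i y j assume i: "i \<in> set [a..<Suc b]" and iy: "(i, y) \<in> set T"
    then have "norm (?p i - ?q y) < r" using near by blast
    from coord_bounds[OF this, of j] r
    \<comment> \<open>For \<open>y = e\<close>, minimality gives \<open>b \<le> i\<close>, and the
      piece ends at \<open>b\<close>, so \<open>i = b\<close>.\<close>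
    show "?p i $ j \<in> {lo y $ j..hi y $ j} \<and> ?q y $ j \<in> {lo y $ j..hi y $ j}"
      using first[of i] i iy by (cases "y = e") (auto simp: lo_def hi_def)
  qed
  note collision = coupled_collision[OF \<delta> this]
  have "(\<Sum>y\<in>{c..e}. \<Sum>j\<in>UNIV. hi y $ j - lo y $ j)
      < CARD('n) * r * (2 * real (e - c) + 1)"
  proof -
    have "{c..e} = insert e {c..<e}" using le by auto
    then have "(\<Sum>y\<in>{c..e}. \<Sum>j\<in>UNIV. hi y $ j - lo y $ j) =
        (\<Sum>j\<in>UNIV. hi e $ j - lo e $ j) + (\<Sum>y\<in>{c..<e}. \<Sum>j\<in>UNIV. hi y $ j - lo y $ j)"
      by simp
    also have "(\<Sum>y\<in>{c..<e}. \<Sum>j\<in>UNIV. hi y $ j - lo y $ j) = (\<Sum>y\<in>{c..<e}. CARD('n) * (2 * r))"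
      by (intro sum.cong) (simp_all add: lo_def hi_def)
    also have "\<dots> = CARD('n) * r * (2 * real (e - c))" by simp
    also have "(\<Sum>j\<in>UNIV. hi e $ j - lo e $ j) < (\<Sum>j\<in>(UNIV :: 'n set). r)"
    proof (rule sum_strict_mono)
      fix j :: 'n
      have "hi e $ j - lo e $ j = \<bar>?p b $ j - ?q e $ j\<bar>"
        unfolding lo_def hi_def by (simp add: max_def min_def)
      then show "hi e $ j - lo e $ j < r" using coord_bounds(3)[OF be', of j] by simp
    qed auto
    finally show ?thesis by (simp add: algebra_simps)
  qed
  then have sum: "(\<Sum>y\<in>{c..e}. \<Sum>j\<in>UNIV. hi y $ j - lo y $ j) / \<delta>
      < CARD('n) * r * (2 * real (e - c) + 1) / \<delta>"
    using \<delta> by (rule divide_strict_right_mono)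
  have set: "set [c..<e + 1] = {c..e}" by auto
  show ?thesis using collision sum unfolding subcurve_def set by linarith
qed

section \<open>The joint law of the shifts and the partition\<close>

lemma concat_hash_map:
  "concat_hash \<delta> t (map f [1..<K + 1]) = concat (map (\<lambda>i. basic_hash \<delta> (t i) (f i)) [1..<K + 1])"
  unfolding concat_hash_def
  by (intro arg_cong[of _ _ concat] map_cong) (auto simp del: upt_Suc)

lemma basic_hash_coupled:
  assumes "P \<noteq> []"
  shows "coupled (\<lambda>x y. y = snap \<delta> t x) P (basic_hash \<delta> t P)"
  unfolding basic_hash_def using assms by (rule coupled_remdups_adj)

text \<open>Each piece is coupled with its own hash, and the couplings are glued at the shared
  vertices. The sequence \<open>\<sigma>\<close> stands for the split points of either
  partition.\<close>

lemma concat_hash_coupled: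
  fixes P :: "'n::{finite,linorder} curve" and \<sigma> :: "nat \<Rightarrow> nat"
  assumes \<delta>: "0 < \<delta>" and K: "1 \<le> K"
    and \<sigma>: "\<And>i. i < K \<Longrightarrow> \<sigma> i \<le> \<sigma> (Suc i)" "\<sigma> 0 = 1" "\<sigma> K = length P"
  shows "coupled (\<lambda>x y. norm (x - y) \<le> sqrt (real CARD('n)) * (\<delta> / 2)) P
    (concat_hash \<delta> t (map (\<lambda>i. subcurve P (\<sigma> (i - 1)) (\<sigma> i)) [1..<K + 1]))"
proof -
  let ?R = "\<lambda>x y :: 'n point. norm (x - y) \<le> sqrt (real CARD('n)) * (\<delta> / 2)"
  let ?h = "\<lambda>i. basic_hash \<delta> (t i) (subcurve P (\<sigma> (i - 1)) (\<sigma> i))"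
  have piece: "coupled ?R (subcurve P (\<sigma> (i - 1)) (\<sigma> i)) (?h i)" if "1 \<le> i" "i \<le> K" for i
  proof -
    have "\<sigma> (i - 1) \<le> \<sigma> i" using \<sigma>(1)[of "i - 1"] that by simp
    then have "subcurve P (\<sigma> (i - 1)) (\<sigma> i) \<noteq> []" by (simp add: subcurve_def)
    from basic_hash_coupled[OF this] show ?thesis
      by (rule coupled_mono) (use norm_snap_le[OF \<delta>] in blast)
  qed
  have split: "subcurve P a c = map (\<lambda>i. P ! (i - 1)) [a..<b] @ subcurve P b c" if "a \<le> b" "b \<le> c" for a b c
    using that upt_add_eq_append[of a b "c + 1 - b"] by (simp add: subcurve_def del: upt_Suc)
  \<comment> \<open>The bound \<open>1 \<le> \<sigma> k\<close> is carried along so that the prefix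
    can be split at \<open>\<sigma> k\<close>.\<close>
  have "1 \<le> \<sigma> k \<and> coupled ?R (subcurve P 1 (\<sigma> k)) (concat (map ?h [1..<k + 1]))" if "1 \<le> k" "k \<le> K" for k
    using that
  proof (induction k rule: nat_induct_at_least)
    case base
    then show ?case using piece[of 1] \<sigma>(1)[of 0] \<sigma>(2) by simp
  next
    case (Suc k)
    then have IH: "1 \<le> \<sigma> k" "coupled ?R (subcurve P 1 (\<sigma> k)) (concat (map ?h [1..<k + 1]))" by auto
    have le: "\<sigma> k \<le> \<sigma> (Suc k)" using \<sigma>(1)[of k] Suc by simp
    let ?v = "P ! (\<sigma> k - 1)" and ?ys = "map (\<lambda>i. P ! (i - 1)) [Suc (\<sigma> k)..<\<sigma> (Suc k) + 1]"
    have tail: "subcurve P (\<sigma> k) (\<sigma> (Suc k)) = ?v # ?ys"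
      using le by (simp add: subcurve_def upt_conv_Cons del: upt_Suc)
    have "coupled ?R (map (\<lambda>i. P ! (i - 1)) [1..<\<sigma> k] @ ?v # ?ys) (concat (map ?h [1..<k + 1]) @ ?h (Suc k))"
    proof (rule coupled_glue)
      show "coupled ?R (map (\<lambda>i. P ! (i - 1)) [1..<\<sigma> k] @ [?v]) (concat (map ?h [1..<k + 1]))"
        using IH(2) split[of 1 "\<sigma> k" "\<sigma> k"] IH(1) by (simp add: subcurve_def)
      show "coupled ?R (?v # ?ys) (?h (Suc k))"
        using piece[of "Suc k"] Suc tail by simp
    qed
    then show ?case
      using split[of 1 "\<sigma> k" "\<sigma> (Suc k)"] IH(1) le tail by simp
  qed
  from this[of K] K \<sigma>(3) have "coupled ?R (subcurve P 1 (length P)) (concat (map ?h [1..<K + 1]))" by simp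
  moreover have "subcurve P 1 (length P) = P"
    by (rule nth_equalityI) (auto simp: subcurve_def simp del: upt_Suc)
  ultimately show ?thesis by (simp only: concat_hash_map)
qed

section \<open>Sizes of the query pieces\<close>

context
  fixes K m :: nat
  assumes K: "1 \<le> K" and m: "1 \<le> m"
begin

text \<open>\<open>K\<close> steps reach the last vertex, so the final split point is
  \<open>m\<close>.\<close>

lemma query_split_step: "K * nat \<lceil>(real m - 1) / real K\<rceil> \<ge> m - 1"
proof -
  have "(real m - 1) / real K \<le> nat \<lceil>(real m - 1) / real K\<rceil>" by linarith
  then have "real m - 1 \<le> real K * nat \<lceil>(real m - 1) / real K\<rceil>"
    using K by (simp add: field_simps)
  then have "real (m - 1) \<le> real (K * nat \<lceil>(real m - 1) / real K\<rceil>)"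
    using m by (simp add: of_nat_diff)
  then show ?thesis by linarith
qed

lemma query_split_step_le:
  assumes "m \<le> K * L"
  shows "nat \<lceil>(real m - 1) / real K\<rceil> \<le> L"
proof -
  have "real m \<le> real K * real L" using assms by (metis of_nat_le_iff of_nat_mult)
  then have "(real m - 1) / real K \<le> real L" using K by (simp add: field_simps)
  then have "\<lceil>(real m - 1) / real K\<rceil> \<le> int L" by linarith
  then show ?thesis by linarith
qed

lemma query_split_bounds:
  "query_split K m 0 = 1" "query_split K m K = m"
  "query_split K m i \<le> query_split K m (Suc i)" "1 \<le> query_split K m i" "query_split K m i \<le> m"
  using m query_split_step by (auto simp: query_split_def min_def)

lemma query_split_diff:
  assumes "m \<le> K * L"
  shows "query_split K m (Suc i) - query_split K m i \<le> L"
proof -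
  define u where "u = nat \<lceil>(real m - 1) / real K\<rceil>"
  have "u \<le> L" using query_split_step_le[OF assms] by (simp add: u_def)
  then show ?thesis unfolding query_split_def u_def[symmetric] by (simp add: min_def) arith
qed

text \<open>If the step is shorter than \<open>L\<close>, so is the last piece. If it equals
  \<open>L\<close>, the earlier pieces use \<open>(K - 1) * L\<close> of the
  \<open>m - 1 < K * L\<close> edges and leave fewer than \<open>L\<close>. The gain of one over
  \<open>query_split_diff\<close> makes up for the missing first match.\<close>

lemma query_split_diff_last:
  assumes "m \<le> K * L"
  shows "query_split K m K - query_split K m (K - 1) < L"
proof -
  define u where "u = nat \<lceil>(real m - 1) / real K\<rceil>"
  have u: "u \<le> L" "m - 1 \<le> K * u"
    using query_split_step query_split_step_le[OF assms] unfolding u_def by auto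
  have L: "1 \<le> L" using assms m by (cases L) auto
  have "K * u = (K - 1) * u + u" using K by (cases K) auto
  moreover have "K * L = (K - 1) * u + L" if "u = L" using K that by (cases K) auto
  ultimately have "m - (1 + (K - 1) * u) < L" using u L m assms by (cases "u = L") auto
  moreover have "query_split K m (K - 1) = min (1 + (K - 1) * u) m"
    by (simp add: query_split_def u_def)
  ultimately show ?thesis using L by (auto simp: query_split_bounds(2) min_def)
qed

end

section \<open>Events and probabilities under the joint law\<close>

lemma card_split_seqs: "finite (split_seqs K m)" "card (split_seqs K m) \<le> m ^ (K - 1)"
proof -
  have sub: "split_seqs K m \<subseteq> {s. set s \<subseteq> {1..m} \<and> length s = K - 1}" by (auto simp: split_seqs_def)
  moreover have fin: "finite {s. set s \<subseteq> {1..m} \<and> length s = K - 1}" by (rule finite_lists_length_eq) simp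
  ultimately show "finite (split_seqs K m)" by (rule finite_subset)
  show "card (split_seqs K m) \<le> m ^ (K - 1)"
    using card_mono[OF fin sub] card_lists_length_eq[of "{1..m}" "K - 1"] by simp
qed

lemma split_seqs_nonempty: "1 \<le> m \<Longrightarrow> split_seqs K m \<noteq> {}"
  by (auto simp: split_seqs_def intro!: exI[of _ "replicate (K - 1) 1"])

lemma prob_space_hash_law:
  assumes "0 < \<delta>"
  shows "prob_space (hash_law \<delta> K m :: ((nat \<Rightarrow> 'n::finite point) \<times> nat list) measure)"
proof -
  interpret A: prob_space "\<Pi>\<^sub>M i\<in>{1..K}. uniform_measure lborel (cube \<delta> :: 'n point set)"
    by (intro prob_space_PiM prob_space_uniform_cube assms)
  interpret pair_prob_space "\<Pi>\<^sub>M i\<in>{1..K}. uniform_measure lborel (cube \<delta> :: 'n point set)"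
    "measure_pmf (pmf_of_set (split_seqs K m))" ..
  show ?thesis unfolding hash_law_def by (rule prob_space_axioms)
qed

text \<open>For each fixed \<open>s\<close> both hashes are random curves. There are countably many
  \<open>s\<close>, so the events can be combined along \<open>snd\<close>.\<close>

lemma hash_law_collision_event:
  fixes P Q :: "'n::{finite,linorder} curve"
  assumes "0 < \<delta>"
  shows "{ts \<in> space (hash_law \<delta> K m). hash_input \<delta> K (fst ts) (snd ts) P = hash_query \<delta> K (fst ts) Q}
    \<in> sets (hash_law \<delta> K m)"
proof -
  let ?L = "hash_law \<delta> K m :: ((nat \<Rightarrow> 'n point) \<times> nat list) measure"
  have t: "(\<lambda>ts. fst ts i) \<in> borel_measurable ?L" if "i \<in> {1..K}" for i
    unfolding hash_law_def using that
    by (intro measurable_compose[OF measurable_fst]) (simp add: measurable_component_singleton)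
  have rc: "random_curve ?L (\<lambda>ts. concat (map (\<lambda>i. basic_hash \<delta> (fst ts i) (f i)) [1..<K + 1]))"
    for f :: "nat \<Rightarrow> 'n curve"
    by (intro random_curve_concat random_curve_basic_hash assms t) (auto simp del: upt_Suc)
  have [measurable]: "snd \<in> measurable ?L (count_space UNIV)"
    unfolding hash_law_def using measurable_snd by (simp add: measurable_def)
  have "Measurable.pred ?L (\<lambda>ts. hash_input \<delta> K (fst ts) s P = hash_query \<delta> K (fst ts) Q)" for s
    unfolding hash_input_def hash_query_def input_partition_def query_partition_def concat_hash_map
    by (intro pred_random_curve_eq rc)
  then have "Measurable.pred ?L (\<lambda>ts. hash_input \<delta> K (fst ts) (snd ts) P = hash_query \<delta> K (fst ts) Q)"
    by (rule measurable_compose_countable) measurable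
  then show ?thesis by (simp add: pred_def)
qed

text \<open>A single favourable \<open>s\<close> suffices: \<open>E\<close> contains a product of
  events times \<open>{s}\<close>, and independence makes the probabilities multiply.\<close>

lemma hash_law_prob_ge:
  fixes H :: "nat \<Rightarrow> 'n::finite point set"
  assumes \<delta>: "0 < \<delta>" and s: "s \<in> split_seqs K m" and H: "\<And>i. i \<in> {1..K} \<Longrightarrow> H i \<in> sets borel"
    and E: "E \<in> sets (hash_law \<delta> K m)"
    and sub: "\<And>t. t \<in> (\<Pi>\<^sub>E i\<in>{1..K}. H i) \<Longrightarrow> (t, s) \<in> E"
  shows "(\<Prod>i\<in>{1..K}. measure (uniform_measure lborel (cube \<delta>)) (H i)) / card (split_seqs K m)
    \<le> measure (hash_law \<delta> K m) E"
proof -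
  let ?N = "uniform_measure lborel (cube \<delta>) :: 'n point measure"
  let ?S = "measure_pmf (pmf_of_set (split_seqs K m))"
  interpret N: prob_space ?N by (rule prob_space_uniform_cube[OF \<delta>])
  interpret PN: finite_product_prob_space "\<lambda>_. ?N" "{1..K}" by unfold_locales simp
  interpret PS: pair_prob_space "\<Pi>\<^sub>M i\<in>{1..K}. ?N" ?S ..
  interpret L: prob_space "hash_law \<delta> K m :: ((nat \<Rightarrow> 'n point) \<times> nat list) measure"
    by (rule prob_space_hash_law[OF \<delta>])
  have H': "H i \<in> sets ?N" if "i \<in> {1..K}" for i using H[OF that] by simp
  have meas: "(\<Pi>\<^sub>E i\<in>{1..K}. H i) \<in> sets (\<Pi>\<^sub>M i\<in>{1..K}. ?N)"
    using H' by (intro sets_PiM_I_finite) auto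
  have "measure (hash_law \<delta> K m) ((\<Pi>\<^sub>E i\<in>{1..K}. H i) \<times> {s}) =
      measure (\<Pi>\<^sub>M i\<in>{1..K}. ?N) (\<Pi>\<^sub>E i\<in>{1..K}. H i) * measure ?S {s}"
    unfolding hash_law_def using meas
    by (simp add: measure_def measure_pmf.emeasure_pair_measure_Times enn2real_mult)
  also have "measure (\<Pi>\<^sub>M i\<in>{1..K}. ?N) (\<Pi>\<^sub>E i\<in>{1..K}. H i) = (\<Prod>i\<in>{1..K}. measure ?N (H i))"
    using H' by (rule PN.prob_times)
  also have "measure ?S {s} = 1 / card (split_seqs K m)"
    using s card_split_seqs(1)[of K m] by (subst measure_pmf_single, subst pmf_of_set) auto
  finally have "(\<Prod>i\<in>{1..K}. measure ?N (H i)) / card (split_seqs K m) =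
      measure (hash_law \<delta> K m) ((\<Pi>\<^sub>E i\<in>{1..K}. H i) \<times> {s})" by simp
  also have "\<dots> \<le> measure (hash_law \<delta> K m) E"
    using E sub by (intro L.finite_measure_mono) auto
  finally show ?thesis .
qed

text \<open>The second component ranges over all lists, so its validity as a split sequence holds
  only almost surely.\<close>

lemma AE_hash_law:
  assumes "0 < \<delta>" and "1 \<le> m"
  shows "AE ts in (hash_law \<delta> K m :: ((nat \<Rightarrow> 'n::finite point) \<times> nat list) measure). snd ts \<in> split_seqs K m"
proof -
  interpret A: prob_space "\<Pi>\<^sub>M i\<in>{1..K}. uniform_measure lborel (cube \<delta> :: 'n point set)"
    by (intro prob_space_PiM prob_space_uniform_cube assms)
  interpret S: pair_prob_space "\<Pi>\<^sub>M i\<in>{1..K}. uniform_measure lborel (cube \<delta> :: 'n point set)"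
    "measure_pmf (pmf_of_set (split_seqs K m))" ..
  have "AE s in measure_pmf (pmf_of_set (split_seqs K m)). s \<in> split_seqs K m"
    using split_seqs_nonempty[OF assms(2)] card_split_seqs(1) by (simp add: AE_measure_pmf_iff)
  moreover have "{ts \<in> space (hash_law \<delta> K m :: ((nat \<Rightarrow> 'n point) \<times> nat list) measure).
      snd ts \<in> split_seqs K m} \<in> sets (hash_law \<delta> K m)"
  proof -
    have "snd \<in> measurable (hash_law \<delta> K m :: ((nat \<Rightarrow> 'n point) \<times> nat list) measure)
        (measure_pmf (pmf_of_set (split_seqs K m)))"
      unfolding hash_law_def by (rule measurable_snd)
    from measurable_sets[OF this, of "split_seqs K m"] show ?thesis
      by (simp add: vimage_def Int_def conj_commute)
  qed
  ultimately show ?thesis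
    unfolding hash_law_def by (intro S.AE_pair_measure) auto
qed

section \<open>Far and near curves\<close>

text \<open>Both curves are coupled with the common hash within
  \<open>sqrt d * \<delta> / 2\<close>, and the couplings compose. This holds for every
  \<open>t\<close>, without probability.\<close>

lemma frechet_le_of_hash_eq:
  fixes P Q :: "'n::{finite,linorder} curve"
  assumes \<delta>: "0 < \<delta>" and K: "1 \<le> K" and Q: "Q \<noteq> []" and s: "s \<in> split_seqs K (length P)" and P: "P \<noteq> []"
    and eq: "hash_input \<delta> K t s P = hash_query \<delta> K t Q"
  shows "frechet P Q \<le> sqrt (real CARD('n)) * \<delta>"
proof -
  define \<sigma> where "\<sigma> i = (1 # s @ [length P]) ! i" for i
  have s': "length s = K - 1" "set s \<subseteq> {1..length P}" "sorted s" using s by (auto simp: split_seqs_def)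
  have "sorted (1 # s @ [length P])"
    using s' P by (fastforce simp: sorted_append Suc_le_eq)
  then have mono: "\<sigma> i \<le> \<sigma> (Suc i)" if "i < K" for i
    unfolding \<sigma>_def using that s'(1) by (intro sorted_nth_mono) auto
  have ends: "\<sigma> 0 = 1" "\<sigma> K = length P"
    unfolding \<sigma>_def using s'(1) K by (auto simp: nth_Cons' nth_append)
  let ?h = "hash_query \<delta> K t Q" and ?e = "sqrt (real CARD('n)) * (\<delta> / 2)"
  have "coupled (\<lambda>x y. norm (x - y) \<le> ?e) P ?h"
    using concat_hash_coupled[OF \<delta> K mono ends, of t] eq
    by (simp add: hash_input_def input_partition_def \<sigma>_def)
  moreover have "coupled (\<lambda>x y. norm (x - y) \<le> ?e) Q ?h"
    using concat_hash_coupled[OF \<delta> K, of "query_split K (length Q)" Q t]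
      query_split_bounds[OF K, of "length Q"] Q
    by (simp add: hash_query_def query_partition_def Suc_le_eq)
  then have "coupled (\<lambda>y x. norm (x - y) \<le> ?e) ?h Q" by (rule coupled_sym)
  ultimately have "coupled ((\<lambda>x y. norm (x - y) \<le> ?e) OO (\<lambda>y x. norm (x - y) \<le> ?e)) P Q"
    by (rule coupled_trans)
  then have "coupled (\<lambda>x y. norm (x - y) \<le> 2 * ?e) P Q"
  proof (rule coupled_mono)
    fix x z :: "'n point"
    assume "((\<lambda>x y. norm (x - y) \<le> ?e) OO (\<lambda>y x. norm (x - y) \<le> ?e)) x z"
    then obtain y where y: "norm (x - y) \<le> ?e" "norm (z - y) \<le> ?e" by blast
    have "norm (x - z) \<le> norm (x - y) + norm (y - z)" by (metis diff_add_cancel norm_triangle_ineq add_diff_eq)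
    then show "norm (x - z) \<le> 2 * ?e" using y by (simp add: norm_minus_commute)
  qed
  from frechet_le[OF this] show ?thesis by simp
qed

text \<open>For one partition, read off from the traversal, each of the \<open>K\<close> independent
  shifts succeeds with probability above \<open>1 / 4\<close>; that partition is one of at most
  \<open>m ^ (K - 1)\<close>.\<close>

lemma hash_law_collision_prob:
  fixes P Q :: "'n::{finite,linorder} curve" and r \<delta> :: real
  assumes P: "P \<noteq> []" and Q: "Q \<noteq> []" and K: "1 \<le> K" and r: "0 < r" and near: "frechet P Q < r"
    and L: "length Q \<le> K * L" "1 \<le> L" and \<delta>: "\<delta> = 4 * CARD('n) * r * L"
  shows "(1 / 4) ^ K * (1 / length P) ^ (K - 1) < measure (hash_law \<delta> K (length P))
    {ts \<in> space (hash_law \<delta> K (length P)). hash_input \<delta> K (fst ts) (snd ts) P = hash_query \<delta> K (fst ts) Q}"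
    (is "_ < measure ?L ?E")
proof -
  let ?m = "length P" and ?\<rho> = "query_split K (length Q)"
  have \<delta>0: "0 < \<delta>" using \<delta> r L by simp
  have Q1: "1 \<le> length Q" and P1: "1 \<le> ?m" using P Q by (auto simp: Suc_le_eq)
  note \<rho> = query_split_bounds[OF K Q1]
  obtain T where T: "T \<in> traversals ?m (length Q)"
    and TR: "\<forall>(i, j) \<in> set T. norm (P ! (i - 1) - Q ! (j - 1)) < r"
    using frechet_less[OF near P Q] by blast
  have T1: "(1, 1) \<in> set T" "(?m, length Q) \<in> set T"
    using T unfolding traversals_def by (auto dest: hd_in_set last_in_set)
  define first where "first j = (LEAST i. (i, j) \<in> set T)" for j
  have first: "(first j, j) \<in> set T" "\<And>i. (i, j) \<in> set T \<Longrightarrow> first j \<le> i" if "j \<in> {1..length Q}" for j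
    using LeastI_ex[OF traversal_covers[OF T that]] by (auto simp: first_def intro: Least_le)
  \<comment> \<open>The final split point must be the last vertex of \<open>P\<close>, even if an
    earlier vertex is already matched with the end of \<open>Q\<close>.\<close>
  define \<sigma> where "\<sigma> i = (if i = K then ?m else first (?\<rho> i))" for i
  have \<sigma>: "(\<sigma> i, ?\<rho> i) \<in> set T" if "i \<le> K" for i
    using first(1)[of "?\<rho> i"] \<rho> T1 that by (auto simp: \<sigma>_def)
  have bounds: "1 \<le> \<sigma> i" "\<sigma> i \<le> ?m" if "i \<le> K" for i
    using traversals_bounds(2)[OF T] \<sigma>[OF that] by auto
  have \<sigma>_mono: "\<sigma> i \<le> \<sigma> (Suc i)" if i: "i < K" for i
  proof (cases "?\<rho> i = ?\<rho> (Suc i)")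
    case True
    \<comment> \<open>Split points coincide once \<open>Q\<close> has run out of vertices.
      Comparability then decides nothing, but \<open>first\<close> is minimal among all matches of
      that vertex.\<close>
    then show ?thesis using first(2)[of "?\<rho> i" "\<sigma> (Suc i)"] \<sigma>[of "Suc i"] \<rho> i by (auto simp: \<sigma>_def)
  next
    case False
    then show ?thesis
      using traversal_comparable[OF T \<sigma>[of i] \<sigma>[of "Suc i"]] \<rho>(3)[of i] i by auto
  qed
  have \<sigma>0: "\<sigma> 0 = 1"
    using first(2)[of 1 1] T1 bounds(1)[of 0] \<rho>(1) K Q1 by (auto simp: \<sigma>_def)
  define s where "s = map \<sigma> [1..<K]"
  have s_eq: "1 # s @ [?m] = map \<sigma> [0..<K + 1]"
    using \<sigma>0 K by (auto simp: s_def upt_conv_Cons[of 0 K] \<sigma>_def)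
  have "sorted (map \<sigma> [0..<K + 1])"
    using \<sigma>_mono by (intro sorted_iff_nth_Suc[THEN iffD2]) (auto simp: less_Suc_eq_le simp del: upt_Suc)
  then have "sorted s" unfolding s_eq[symmetric] by (simp add: sorted_append)
  then have s: "s \<in> split_seqs K ?m" using bounds by (auto simp: split_seqs_def s_def)
  have input: "input_partition K s P = map (\<lambda>i. subcurve P (\<sigma> (i - 1)) (\<sigma> i)) [1..<K + 1]"
    unfolding input_partition_def s_eq
    by (intro map_cong) (auto simp del: upt_Suc)
  define H where "H i = {t. basic_hash \<delta> t (subcurve P (\<sigma> (i - 1)) (\<sigma> i))
    = basic_hash \<delta> t (subcurve Q (?\<rho> (i - 1)) (?\<rho> i))}" for i
  have H_sets: "H i \<in> sets borel" for i
  proof -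
    have "random_curve borel (\<lambda>t. basic_hash \<delta> t R)" for R :: "'n curve"
      by (rule random_curve_basic_hash[OF \<delta>0]) simp
    from pred_random_curve_eq[OF this this] show ?thesis by (simp add: pred_def H_def)
  qed
  have H_prob: "1 / 4 < measure (uniform_measure lborel (cube \<delta>)) (H i)" if i: "i \<in> {1..K}" for i
  proof -
    have pm: "(\<sigma> (i - 1), ?\<rho> (i - 1)) \<in> set T" "(\<sigma> i, ?\<rho> i) \<in> set T"
      "\<sigma> (i - 1) \<le> \<sigma> i" "?\<rho> (i - 1) \<le> ?\<rho> i"
      using \<sigma>[of "i - 1"] \<sigma>[of i] \<sigma>_mono[of "i - 1"] \<rho>(3)[of "i - 1"] i by auto
    have frac: "CARD('n) * r * x / \<delta> = x / (4 * L)" for x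
      using r L by (simp add: \<delta>)
    show ?thesis
    proof (cases "i = K")
      case True
      \<comment> \<open>The last piece of \<open>Q\<close> has at most \<open>L\<close> vertices, so
        even full width for each costs at most \<open>1 / 2\<close>.\<close>
      have "?\<rho> i - ?\<rho> (i - 1) + 1 \<le> L"
        using query_split_diff_last[OF K Q1 L(1)] True by simp
      then have "real (?\<rho> i - ?\<rho> (i - 1)) + 1 \<le> L" by linarith
      then have "(2 * real (?\<rho> i - ?\<rho> (i - 1)) + 2) / (4 * L) \<le> 1 / 2" using L(2) by (simp add: field_simps)
      then show ?thesis
        using collision_full[OF \<delta>0 r T TR pm] unfolding H_def frac by linarith
    next
      case False
      have "real (?\<rho> i - ?\<rho> (i - 1)) \<le> L"
        using query_split_diff[OF K Q1 L(1), of "i - 1"] i by simp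
      \<comment> \<open>Equality is possible for \<open>L = 1\<close>; the strict bound of
        \<open>collision_first_match\<close> still gives more than \<open>1 / 4\<close>.\<close>
      then have "(2 * real (?\<rho> i - ?\<rho> (i - 1)) + 1) / (4 * L) \<le> 3 / 4" using L(2) by (simp add: field_simps)
      moreover have first_match: "\<sigma> i \<le> k" if "(k, ?\<rho> i) \<in> set T" for k
        using first(2)[of "?\<rho> i" k] that False \<rho> by (auto simp: \<sigma>_def)
      ultimately show ?thesis
        using collision_first_match[OF \<delta>0 r T TR pm first_match] unfolding H_def frac by linarith
    qed
  qed
  have "(1 / 4) ^ K = (\<Prod>i\<in>{1..K}. 1 / 4 :: real)" by simp
  also have "\<dots> < (\<Prod>i\<in>{1..K}. measure (uniform_measure lborel (cube \<delta>)) (H i))"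
  proof (rule prod_mono_strict)
    show "1 \<in> {1..K}" using K by simp
    then show "1 / 4 < measure (uniform_measure lborel (cube \<delta>)) (H 1)" by (rule H_prob)
    show "0 \<le> (1 / 4 :: real) \<and> 1 / 4 \<le> measure (uniform_measure lborel (cube \<delta>)) (H i)"
      and "0 < measure (uniform_measure lborel (cube \<delta>)) (H i)" if "i \<in> {1..K}" for i
      using H_prob[OF that] by linarith+
  qed simp
  finally have prod: "(1 / 4) ^ K < (\<Prod>i\<in>{1..K}. measure (uniform_measure lborel (cube \<delta>)) (H i))" .
  have "0 < card (split_seqs K ?m)" using s card_split_seqs(1) by (auto simp: card_gt_0_iff)
  moreover have "real (card (split_seqs K ?m)) \<le> real ?m ^ (K - 1)"
    using card_split_seqs(2)[of K ?m] by (metis of_nat_le_iff of_nat_power)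
  ultimately have "(1 / 4) ^ K / real ?m ^ (K - 1) \<le> (1 / 4) ^ K / card (split_seqs K ?m)"
    by (intro frac_le) auto
  moreover have "(1 / 4) ^ K * (1 / real ?m) ^ (K - 1) = (1 / 4) ^ K / real ?m ^ (K - 1)"
    by (simp add: power_one_over)
  ultimately have "(1 / 4) ^ K * (1 / ?m) ^ (K - 1) \<le> (1 / 4) ^ K / card (split_seqs K ?m)"
    by linarith
  also have "\<dots> < (\<Prod>i\<in>{1..K}. measure (uniform_measure lborel (cube \<delta>)) (H i)) / card (split_seqs K ?m)"
    using prod \<open>0 < card (split_seqs K ?m)\<close> by (intro divide_strict_right_mono) auto
  also have "\<dots> \<le> measure ?L ?E"
  proof (rule hash_law_prob_ge[OF \<delta>0 s H_sets hash_law_collision_event[OF \<delta>0]])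
    fix t assume t: "t \<in> (\<Pi>\<^sub>E i\<in>{1..K}. H i)"
    then have "hash_input \<delta> K t s P = hash_query \<delta> K t Q"
      unfolding hash_input_def hash_query_def input query_partition_def concat_hash_map
      by (intro arg_cong[of _ _ concat] map_cong) (auto simp: H_def PiE_iff simp del: upt_Suc)
    moreover have "(t, s) \<in> space ?L"
      using t by (auto simp: hash_law_def space_pair_measure space_PiM PiE_iff)
    ultimately show "(t, s) \<in> ?E" by simp
  qed
  finally show ?thesis .
qed

theorem corollary11:
  fixes P Q :: "'n::{finite,linorder} curve"
    and K M m1 m2 :: nat
    and r \<delta> c :: real
  assumes "P \<noteq> []" and "Q \<noteq> []"
    and "m1 = length P" and "m2 = length Q" and "M = max m1 m2"
    and "K \<ge> 1" and "r > 0"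
    and "\<delta> = 4 * real CARD('n) * r * of_int \<lceil>real M / real K\<rceil>"
    and "c = 4 * real CARD('n) powr (3 / 2) * of_int \<lceil>real M / real K\<rceil>"
  shows "(frechet P Q < r \<longrightarrow>
            \<P>(ts in hash_law \<delta> K m1.
                hash_input \<delta> K (fst ts) (snd ts) P = hash_query \<delta> K (fst ts) Q)
              > (1 / 4) ^ K * (1 / real M) ^ (K - 1)) \<and>
         (frechet P Q > c * r \<longrightarrow>
            \<P>(ts in hash_law \<delta> K m1.
                hash_input \<delta> K (fst ts) (snd ts) P = hash_query \<delta> K (fst ts) Q) = 0)"
proof -
  define L where "L = nat \<lceil>real M / real K\<rceil>"
  have M: "1 \<le> m1" "m1 \<le> M" "m2 \<le> M" using assms(1,3,5) by (auto simp: Suc_le_eq)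
  have "0 < real M / real K" using M assms(6) by simp
  then have L: "1 \<le> L" "real L = of_int \<lceil>real M / real K\<rceil>" "real M / real K \<le> real L"
    unfolding L_def by linarith+
  have "real M \<le> real (K * L)" using L(3) assms(6) by (simp add: field_simps)
  then have KL: "M \<le> K * L" by linarith
  have \<delta>: "\<delta> = 4 * CARD('n) * r * L" using assms(8) L by simp
  have \<delta>0: "0 < \<delta>" unfolding \<delta> using L(1) assms(7) by simp
  have "(1 / 4) ^ K * (1 / real M) ^ (K - 1) < \<P>(ts in hash_law \<delta> K m1.
      hash_input \<delta> K (fst ts) (snd ts) P = hash_query \<delta> K (fst ts) Q)" if "frechet P Q < r"
  proof -
    have "(1 / 4) ^ K * (1 / real M) ^ (K - 1) \<le> (1 / 4) ^ K * (1 / real m1) ^ (K - 1)"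
      using M by (intro mult_left_mono power_mono) (auto simp: frac_le)
    also have "\<dots> < \<P>(ts in hash_law \<delta> K m1.
        hash_input \<delta> K (fst ts) (snd ts) P = hash_query \<delta> K (fst ts) Q)"
      using hash_law_collision_prob[OF assms(1,2,6,7) that _ L(1) \<delta>] KL M assms(3,4) by simp
    finally show ?thesis .
  qed
  moreover have "\<P>(ts in hash_law \<delta> K m1.
      hash_input \<delta> K (fst ts) (snd ts) P = hash_query \<delta> K (fst ts) Q) = 0" if far: "c * r < frechet P Q"
  proof -
    \<comment> \<open>With \<open>d powr (3 / 2) = d * sqrt d\<close>, the threshold
      \<open>c * r\<close> is exactly the bound of \<open>frechet_le_of_hash_eq\<close>.\<close>
    have "real CARD('n) powr (3 / 2) = real CARD('n) * sqrt (real CARD('n))"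
      using powr_add[of "real CARD('n)" 1 "1 / 2"] by (simp add: powr_half_sqrt)
    then have "c * r = sqrt (real CARD('n)) * \<delta>" using assms(9) by (simp add: \<delta> L)
    then have "hash_input \<delta> K t s P \<noteq> hash_query \<delta> K t Q" if "s \<in> split_seqs K m1" for t s
      using frechet_le_of_hash_eq[OF \<delta>0 assms(6,2), of s P t] that far assms(1,3) by auto
    then have "AE ts in hash_law \<delta> K m1. \<not> hash_input \<delta> K (fst ts) (snd ts) P = hash_query \<delta> K (fst ts) Q"
      using AE_hash_law[OF \<delta>0 M(1), where K = K and 'n = 'n] by (auto elim!: eventually_mono)
    then have "emeasure (hash_law \<delta> K m1) {ts \<in> space (hash_law \<delta> K m1).
        hash_input \<delta> K (fst ts) (snd ts) P = hash_query \<delta> K (fst ts) Q} = 0"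
      using hash_law_collision_event[OF \<delta>0] by (intro emeasure_eq_0_AE) auto
    then show ?thesis by (simp add: measure_def)
  qed
  ultimately show ?thesis by blast
qed

end
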